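(* Let $M$ be a tame matroid (possibly infinite) and let $k$ be a finite field. Then the following are equivalent. (1) $M$ is a thin sums matroid over $k$. (2) $M$ is $k$-paintable. (3) Every finite minor of $M$ is representable over $k$.
   Context: Matroids may be infinite, in the following sense: a matroid on a set $E$ is given by a family $\mathcal{I}\subseteq\mathcal{P}(E)$ of independent sets such that (I1) $\emptyset\in\mathcal{I}$; (I2) $\mathcal{I}$ is closed under subsets; (I3) whenever $I,I'\in\mathcal{I}$ with $I'$ maximal and $I$ not maximal, there is $x\in I'\setminus I$ with $I\cup\{x\}\in\mathcal{I}$; (IM) whenever $I\subseteq X\subseteq E$ and $I\in\mathcal{I}$, the set $\{I'\in\mathcal{I}\mid I\subseteq I'\subseteq X\}$ has a maximal element. Bases are maximal independent sets, circuits are minimal dependent sets; the dual $M^*$ has as bases the complements of bases of $M$, and cocircuits of $M$ are circuits of $M^*$. Deletion $M\backslash D$ has as independent sets the independent sets of $M$ disjoint from $D$; contraction is $M/C=(M^*\backslash C)^*$; minors are matroids $M/C\backslash D$ with $C,D$ disjoint; a minor is finite if its ground set is finite. A matroid is tame if every intersection of a circuit with a cocircuit is finite. A finite matroid is representable over $k$ if it is the matroid of linear independence of some family of vectors (indexed by its ground set) in a $k$-vector space. Thin sums matroids: let $A$ be a set and $f=(f_e\mid e\in E)$ a family of functions $A\to k$. A family $\lambda=(\lambda_e\mid e\in E)$ of elements of $k$ is a thin dependence of $f$ if for each $a\in A$ we have $\sum_{e\in E}\lambda_e f_e(a)=0$, where this includes the requirement that only finitely many summands are nonzero. A set $I\subseteq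 E$ is thinly independent for $f$ if the only thin dependence of $f$ that is $0$ everywhere outside $I$ is the zero family. A matroid $M$ on $E$ is a thin sums matroid over $k$ if there are such $A$ and $f$ for which the independent sets of $M$ are precisely the thinly independent sets for $f$. Paintings: let $k^*$ be the set of nonzero elements of $k$. A $k$-painting of $M$ is a choice of a function $c_o\colon o\to k^*$ for each circuit $o$ of $M$ and a function $d_b\colon b\to k^*$ for each cocircuit $b$ of $M$ such that for every circuit $o$ and cocircuit $b$ we have $\sum_{e\in o\cap b}c_o(e)d_b(e)=0$ (which includes the requirement that only finitely many summands are nonzero). $M$ is $k$-paintable if it has a $k$-painting. *)

theory Defs
  imports Complex_Main "HOL-Library.Function_Algebras"
begin

section \<open>Matroids\<close>

record 'e indep_system =
  ground :: "'e set"
  indeps :: "'e set set"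

definition maximal_in :: "'e set set \<Rightarrow> 'e set \<Rightarrow> bool" where
  "maximal_in F X \<longleftrightarrow> X \<in> F \<and> (\<forall>Y\<in>F. X \<subseteq> Y \<longrightarrow> Y = X)"

definition minimal_in :: "'e set set \<Rightarrow> 'e set \<Rightarrow> bool" where
  "minimal_in F X \<longleftrightarrow> X \<in> F \<and> (\<forall>Y\<in>F. Y \<subseteq> X \<longrightarrow> Y = X)"

definition basis :: "'e indep_system \<Rightarrow> 'e set \<Rightarrow> bool" where
  "basis M B \<longleftrightarrow> maximal_in (indeps M) B"

locale matroid =
  fixes M :: "'e indep_system"
  assumes indeps_ground: "indeps M \<subseteq> Pow (ground M)"
    and I1: "{} \<in> indeps M"
    and I2: "\<And>I J. J \<in> indeps M \<Longrightarrow> I \<subseteq> J \<Longrightarrow> I \<in> indeps M"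
    and I3: "\<And>I I'. I \<in> indeps M \<Longrightarrow> I' \<in> indeps M \<Longrightarrow>
        maximal_in (indeps M) I' \<Longrightarrow> \<not> maximal_in (indeps M) I \<Longrightarrow>
        \<exists>x\<in>I' - I. insert x I \<in> indeps M"
    and IM: "\<And>I X. I \<in> indeps M \<Longrightarrow> I \<subseteq> X \<Longrightarrow> X \<subseteq> ground M \<Longrightarrow>
        \<exists>B. maximal_in {I' \<in> indeps M. I \<subseteq> I' \<and> I' \<subseteq> X} B"

definition circuit :: "'e indep_system \<Rightarrow> 'e set \<Rightarrow> bool" where
  "circuit M C \<longleftrightarrow> minimal_in {X. X \<subseteq> ground M \<and> X \<notin> indeps M} C"

definition dual :: "'e indep_system \<Rightarrow> 'e indep_system" where
  "dual M = \<lparr>ground = ground M, indeps = {I. \<exists>B. basis M B \<and> I \<subseteq> ground M - B}\<rparr>"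

text \<open>The dual is given by its independent sets; its bases are the complements of bases of \<open>M\<close>.\<close>

lemma basis_dual_iff:
  assumes "indeps M \<subseteq> Pow (ground M)"
  shows "basis (dual M) B' \<longleftrightarrow> (\<exists>B. basis M B \<and> B' = ground M - B)"
proof
  assume B': "basis (dual M) B'"
  then have B'max: "\<And>J. J \<in> indeps (dual M) \<Longrightarrow> B' \<subseteq> J \<Longrightarrow> J = B'"
    and "B' \<in> indeps (dual M)"
    unfolding basis_def maximal_in_def by auto
  then obtain B where B: "basis M B" "B' \<subseteq> ground M - B"
    by (auto simp: dual_def)
  then have "ground M - B = B'"
    by (intro B'max) (auto simp: dual_def)
  with B show "\<exists>B. basis M B \<and> B' = ground M - B" by blast
next
  assume "\<exists>B. basis M B \<and> B' = ground M - B"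
  then obtain B where B: "basis M B" "B' = ground M - B" by blast
  have "J = B'" if "basis M D" "J \<subseteq> ground M - D" "B' \<subseteq> J" for J D
  proof -
    have "D \<subseteq> ground M" "B \<subseteq> ground M"
      using that(1) B(1) assms by (auto simp: basis_def maximal_in_def)
    then have "D \<subseteq> B" using that B(2) by blast
    then have "B = D"
      using that(1) B(1) by (auto simp: basis_def maximal_in_def)
    then show ?thesis using that B(2) by blast
  qed
  then show "basis (dual M) B'"
    using B unfolding basis_def[of "dual M"] by (auto simp: dual_def maximal_in_def)
qed

definition cocircuit :: "'e indep_system \<Rightarrow> 'e set \<Rightarrow> bool" where
  "cocircuit M b \<longleftrightarrow> circuit (dual M) b"

definition tame :: "'e indep_system \<Rightarrow> bool" where
  "tame M \<longleftrightarrow> (\<forall>C b. circuit M C \<longrightarrow> cocircuit M b \<longrightarrow> finite (C \<inter> b))"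

definition delete :: "'e indep_system \<Rightarrow> 'e set \<Rightarrow> 'e indep_system" where
  "delete M D = \<lparr>ground = ground M - D, indeps = {I \<in> indeps M. I \<inter> D = {}}\<rparr>"

definition contract :: "'e indep_system \<Rightarrow> 'e set \<Rightarrow> 'e indep_system" where
  "contract M C = dual (delete (dual M) C)"

definition minor :: "'e indep_system \<Rightarrow> 'e indep_system \<Rightarrow> bool" where
  "minor N M \<longleftrightarrow> (\<exists>C D. C \<subseteq> ground M \<and> D \<subseteq> ground M \<and> C \<inter> D = {} \<and> N = delete (contract M C) D)"

section \<open>Representability\<close>

text \<open>The family \<open>v\<close> of vectors is indexed by the ground set, so it need not be injective; a
  subfamily is linearly independent iff it is injective with linearly independent range.\<close>

definition represents ::
    "('k::field \<Rightarrow> 'v::ab_group_add \<Rightarrow> 'v) \<Rightarrow> ('e \<Rightarrow> 'v) \<Rightarrow> 'e indep_system \<Rightarrow> bool" where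
  "represents scale v N \<longleftrightarrow> vector_space scale \<and>
     indeps N = {I. I \<subseteq> ground N \<and> inj_on v I \<and> \<not> module.dependent scale (v ` I)}"

definition fun_scale :: "'k::field \<Rightarrow> ('e \<Rightarrow> 'k) \<Rightarrow> 'e \<Rightarrow> 'k" where
  "fun_scale c w = (\<lambda>x. c * w x)"

text \<open>HOL cannot quantify over the type of vectors inside a definition. Using the space of all
  functions from the type of elements to the field loses no generality, by
  \<open>represents_imp_representable\<close> below.\<close>

definition representable :: "'k::field itself \<Rightarrow> 'e indep_system \<Rightarrow> bool" where
  "representable K N \<longleftrightarrow> (\<exists>v :: 'e \<Rightarrow> 'e \<Rightarrow> 'k. represents fun_scale v N)"

lemma vector_space_fun_scale: "vector_space (fun_scale :: 'k::field \<Rightarrow> ('e \<Rightarrow> 'k) \<Rightarrow> 'e \<Rightarrow> 'k)"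
  by unfold_locales (auto simp: fun_scale_def fun_eq_iff algebra_simps)

lemma represents_imp_representable:
  fixes scale :: "'k::field \<Rightarrow> 'v::ab_group_add \<Rightarrow> 'v" and v :: "'e \<Rightarrow> 'v"
  assumes "represents scale v N"
  shows "representable TYPE('k) N"
proof -
  interpret V: vector_space scale using assms by (simp add: represents_def)
  interpret W: vector_space "fun_scale :: 'k \<Rightarrow> ('e \<Rightarrow> 'k) \<Rightarrow> 'e \<Rightarrow> 'k"
    by (rule vector_space_fun_scale)
  interpret P: vector_space_pair scale "fun_scale :: 'k \<Rightarrow> ('e \<Rightarrow> 'k) \<Rightarrow> 'e \<Rightarrow> 'k" ..
  obtain B where B: "B \<subseteq> range v" "V.independent B" "range v \<subseteq> V.span B"
    using V.maximal_independent_subset[of "range v"] by blast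
  define R where "R = V.representation (V.extend_basis B)"
  have ind: "V.independent (V.extend_basis B)" and spn: "V.span (V.extend_basis B) = UNIV"
    using B(2) V.independent_extend_basis V.span_extend_basis by auto
  define \<phi> where "\<phi> w = (\<lambda>x. R w (v x))" for w
  have lin: "Vector_Spaces.linear scale fun_scale \<phi>"
    by unfold_locales
      (auto simp: \<phi>_def R_def fun_scale_def fun_eq_iff ind spn
        V.representation_add V.representation_scale)
  have inj: "inj_on \<phi> (V.span B)"
  proof (subst P.linear_inj_on_iff_eq_0[OF lin V.subspace_span], intro ballI impI)
    fix w assume w: "w \<in> V.span B" "\<phi> w = 0"
    have R: "R w = V.representation B w"
      unfolding R_def using V.representation_extend[OF ind w(1)] V.extend_basis_superset[OF B(2)]
      by simp
    have "V.representation B w b = 0" for b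
    proof (rule ccontr)
      assume nz: "V.representation B w b \<noteq> 0"
      then obtain x where "b = v x" using V.representation_ne_zero B(1) by blast
      with nz w(2) R show False by (auto simp: \<phi>_def fun_eq_iff)
    qed
    then show "w = 0"
      using V.sum_nonzero_representation_eq[OF B(2) w(1)] by simp
  qed
  have eq: "inj_on v I \<and> V.independent (v ` I) \<longleftrightarrow>
      inj_on (\<phi> \<circ> v) I \<and> W.independent ((\<phi> \<circ> v) ` I)" for I
  proof -
    have sub: "V.span (v ` I) \<subseteq> V.span B"
      using B(3) by (intro V.span_minimal) auto
    have injI: "inj_on \<phi> (V.span (v ` I))"
      using inj sub inj_on_subset by blast
    have injJ: "inj_on \<phi> (v ` I)"
      using injI V.span_superset inj_on_subset by blast
    have 1: "inj_on (\<phi> \<circ> v) I \<longleftrightarrow> inj_on v I"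
      using injJ inj_on_imageI2 comp_inj_on by blast
    have "W.dependent (\<phi> ` v ` I)" if dep: "V.dependent (v ` I)"
    proof -
      obtain a where a: "a \<in> v ` I" "a \<in> V.span (v ` I - {a})"
        using dep unfolding V.dependent_def by blast
      have "\<phi> a \<in> W.span (\<phi> ` (v ` I - {a}))"
        using a(2) P.linear_span_image[OF lin] by blast
      moreover have "\<phi> ` (v ` I - {a}) = \<phi> ` v ` I - {\<phi> a}"
        using injJ a(1) by (auto dest: inj_onD)
      ultimately show ?thesis using a(1) unfolding W.dependent_def by auto
    qed
    then have 2: "W.independent (\<phi> ` v ` I) \<longleftrightarrow> V.independent (v ` I)"
      using P.linear_independent_injective_image[OF lin _ injI] by blast
    show ?thesis using 1 2 by (simp add: image_comp)
  qed
  have "represents (fun_scale :: 'k \<Rightarrow> ('e \<Rightarrow> 'k) \<Rightarrow> 'e \<Rightarrow> 'k) (\<phi> \<circ> v) N"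
    using assms vector_space_fun_scale unfolding represents_def by (simp only: eq simp_thms)
  then show ?thesis unfolding representable_def by blast
qed

section \<open>Thin sums matroids and paintings\<close>

text \<open>A sum is zero in the thin sense if it has only finitely many nonzero summands, and these
  add up to zero. (The library's \<open>sum\<close> over an infinite set is always zero.)\<close>

definition thin_sum_zero :: "'e set \<Rightarrow> ('e \<Rightarrow> 'k::field) \<Rightarrow> bool" where
  "thin_sum_zero S g \<longleftrightarrow> finite {e \<in> S. g e \<noteq> 0} \<and> (\<Sum>e\<in>{e \<in> S. g e \<noteq> 0}. g e) = 0"

definition thin_dependence ::
    "'e set \<Rightarrow> 'a set \<Rightarrow> ('e \<Rightarrow> 'a \<Rightarrow> 'k::field) \<Rightarrow> ('e \<Rightarrow> 'k) \<Rightarrow> bool" where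
  "thin_dependence E A f l \<longleftrightarrow> (\<forall>a\<in>A. thin_sum_zero E (\<lambda>e. l e * f e a))"

definition thinly_independent ::
    "'e set \<Rightarrow> 'a set \<Rightarrow> ('e \<Rightarrow> 'a \<Rightarrow> 'k::field) \<Rightarrow> 'e set \<Rightarrow> bool" where
  "thinly_independent E A f I \<longleftrightarrow> I \<subseteq> E \<and>
     (\<forall>l. thin_dependence E A f l \<and> (\<forall>e\<in>E - I. l e = 0) \<longrightarrow> (\<forall>e\<in>E. l e = 0))"

definition thin_represents ::
    "'a set \<Rightarrow> ('e \<Rightarrow> 'a \<Rightarrow> 'k::field) \<Rightarrow> 'e indep_system \<Rightarrow> bool" where
  "thin_represents A f M \<longleftrightarrow> indeps M = {I. thinly_independent (ground M) A f I}"

text \<open>Again the type of the index set \<open>A\<close> has to be fixed; functions from the type of elements to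
  the field suffice, by \<open>thin_represents_imp_thin_sums_matroid\<close> below.\<close>

definition thin_sums_matroid :: "'k::field itself \<Rightarrow> 'e indep_system \<Rightarrow> bool" where
  "thin_sums_matroid K M \<longleftrightarrow>
     (\<exists>(A :: ('e \<Rightarrow> 'k) set) (f :: 'e \<Rightarrow> ('e \<Rightarrow> 'k) \<Rightarrow> 'k). thin_represents A f M)"

lemma thin_represents_imp_thin_sums_matroid:
  fixes f :: "'e \<Rightarrow> 'a \<Rightarrow> 'k::field"
  assumes "thin_represents A f M"
  shows "thin_sums_matroid TYPE('k) M"
proof -
  define A' where "A' = (\<lambda>a e. f e a) ` A"
  have "thin_dependence E A' (\<lambda>e g. g e) l \<longleftrightarrow> thin_dependence E A f l" for E l
    by (simp add: thin_dependence_def A'_def)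
  then have "thin_represents A' (\<lambda>e g. g e) M"
    using assms by (simp add: thin_represents_def thinly_independent_def)
  then show ?thesis unfolding thin_sums_matroid_def by blast
qed

definition painting ::
    "'e indep_system \<Rightarrow> ('e set \<Rightarrow> 'e \<Rightarrow> 'k::field) \<Rightarrow> ('e set \<Rightarrow> 'e \<Rightarrow> 'k) \<Rightarrow> bool" where
  "painting M c d \<longleftrightarrow>
     (\<forall>C. circuit M C \<longrightarrow> (\<forall>e\<in>C. c C e \<noteq> 0)) \<and>
     (\<forall>b. cocircuit M b \<longrightarrow> (\<forall>e\<in>b. d b e \<noteq> 0)) \<and>
     (\<forall>C b. circuit M C \<longrightarrow> cocircuit M b \<longrightarrow> thin_sum_zero (C \<inter> b) (\<lambda>e. c C e * d b e))"

definition paintable :: "'k::field itself \<Rightarrow> 'e indep_system \<Rightarrow> bool" where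
  "paintable K M \<longleftrightarrow> (\<exists>c d :: 'e set \<Rightarrow> 'e \<Rightarrow> 'k. painting M c d)"

end

(*
  Circuits and cocircuits of an infinite matroid never meet in exactly one element, and for every
  partition of the ground set into P, Q and {e} there is a circuit through e inside P + e or a
  cocircuit through e inside Q + e; every argument about the matroid and its minors rests on this.

  (1) ==> (2): each circuit supports a thin dependence. A cocircuit b is painted by comparing its
  elements with a base point along circuits that meet b in two elements; orthogonality to all
  circuits follows since, by compactness, every element of the support of a thin dependence lies
  in a circuit inside that support.
  (2) ==> (1): the colours of the cocircuits are the coordinates of a thin sums representation.
  (2) ==> (3): the coordinates at the cocircuits avoiding C represent M/C - D.
  (3) ==> (2): by tameness each orthogonality condition involves finitely many colours, so by
  compactness finitely many circuits and cocircuits suffice. These are painted by dependences and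
  linear functionals of a representation of a finite minor containing all their intersections.
*)
theory Submission
  imports Defs "HOL-Analysis.Function_Topology"
begin

section \<open>Circuits and cocircuits of infinite matroids\<close>

lemma maximal_inD: "maximal_in F X \<Longrightarrow> X \<in> F"
  by (simp add: maximal_in_def)

lemma ground_dual [simp]: "ground (dual M) = ground M"
  by (simp add: dual_def)

lemma indeps_dual_iff: "Z \<in> indeps (dual M) \<longleftrightarrow> (\<exists>B. basis M B \<and> Z \<subseteq> ground M \<and> Z \<inter> B = {})"
  by (auto simp: dual_def)

lemma circuitD:
  assumes "circuit M C"
  shows "C \<subseteq> ground M" "C \<notin> indeps M" "\<And>Y. Y \<subset> C \<Longrightarrow> Y \<in> indeps M"
  using assms unfolding circuit_def minimal_in_def by blast+

lemma circuit_subset_eq: "circuit M C \<Longrightarrow> circuit M C' \<Longrightarrow> C \<subseteq> C' \<Longrightarrow> C = C'"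
  using circuitD[of M C] circuitD[of M C'] by blast

lemma cocircuit_subset_ground: "cocircuit M b \<Longrightarrow> b \<subseteq> ground M"
  using circuitD(1)[of "dual M" b] by (simp add: cocircuit_def)

context matroid
begin

section \<open>Bases and exchange\<close>

lemma indep_subset_ground: "I \<in> indeps M \<Longrightarrow> I \<subseteq> ground M"
  using indeps_ground by blast

lemma obtain_maximal_indep:
  assumes "I \<in> indeps M" "I \<subseteq> X" "X \<subseteq> ground M"
  obtains J where "J \<in> indeps M" "I \<subseteq> J" "J \<subseteq> X"
    "\<And>K. K \<in> indeps M \<Longrightarrow> J \<subseteq> K \<Longrightarrow> K \<subseteq> X \<Longrightarrow> K = J"
proof -
  obtain J where "maximal_in {I' \<in> indeps M. I \<subseteq> I' \<and> I' \<subseteq> X} J"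
    using IM[OF assms] by blast
  then show ?thesis
    using that[of J] unfolding maximal_in_def by auto
qed

lemma obtain_basis:
  assumes "I \<in> indeps M"
  obtains B where "basis M B" "I \<subseteq> B"
proof -
  obtain J where J: "J \<in> indeps M" "I \<subseteq> J"
      "\<And>K. K \<in> indeps M \<Longrightarrow> J \<subseteq> K \<Longrightarrow> K \<subseteq> ground M \<Longrightarrow> K = J"
    using obtain_maximal_indep[OF assms indep_subset_ground[OF assms] subset_refl] by metis
  then show ?thesis
    using that[of J] indep_subset_ground unfolding basis_def maximal_in_def by auto
qed

lemma basis_indep: "basis M B \<Longrightarrow> B \<in> indeps M"
  and basis_maximal: "basis M B \<Longrightarrow> K \<in> indeps M \<Longrightarrow> B \<subseteq> K \<Longrightarrow> K = B"
  by (auto simp: basis_def maximal_in_def)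

lemma basis_exchange:
  assumes "I \<in> indeps M" "\<not> basis M I" "basis M B"
  obtains x where "x \<in> B - I" "insert x I \<in> indeps M"
  using I3[of I B] assms maximal_inD unfolding basis_def by blast

text \<open>Axiom (I3) compares only with bases of the whole matroid; this is exchange inside
  \<open>X\<close>. If no element of \<open>J - I\<close> could be added to \<open>I\<close>, then,
  for a basis \<open>B\<close> extending \<open>J\<close>, both \<open>I \<union> (B - X)\<close>
  and the same set with \<open>y\<close> added would be bases.\<close>

lemma restricted_exchange:
  assumes I: "I \<in> indeps M" "I \<subseteq> X" and X: "X \<subseteq> ground M"
    and J: "J \<in> indeps M" "J \<subseteq> X" and max: "\<And>K. K \<in> indeps M \<Longrightarrow> J \<subseteq> K \<Longrightarrow> K \<subseteq> X \<Longrightarrow> K = J"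
    and y: "y \<in> X - I" "insert y I \<in> indeps M"
  obtains x where "x \<in> J - I" "insert x I \<in> indeps M"
proof (rule ccontr)
  assume none: "\<not> thesis"
  obtain B where B: "basis M B" "J \<subseteq> B"
    using J(1) by (rule obtain_basis)
  have BX: "B \<inter> X = J"
    using max[of "B \<inter> X"] B J(2) I2[OF basis_indep[OF B(1)]] by blast
  \<comment> \<open>If part of \<open>B - X\<close> were missing from \<open>K\<close>, the set
    \<open>J \<union> (K - X)\<close> would not be a basis; exchange with \<open>K\<close> then adds
    to \<open>J\<close> an element of \<open>X\<close>, against the maximality of
    \<open>J\<close>.\<close>
  have full: "K - X = B - X" if K: "basis M K" "K - X \<subseteq> B - X" for K
  proof (rule ccontr)
    assume "K - X \<noteq> B - X"
    then have psub: "J \<union> (K - X) \<subset> B" using K(2) B(2) BX J(2) by blast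
    then have ind: "J \<union> (K - X) \<in> indeps M" using I2[OF basis_indep[OF B(1)]] by blast
    have "\<not> basis M (J \<union> (K - X))"
      using psub basis_maximal[of "J \<union> (K - X)" B] basis_indep[OF B(1)] by blast
    then obtain x where x: "x \<in> K - (J \<union> (K - X))" "insert x (J \<union> (K - X)) \<in> indeps M"
      using basis_exchange[OF ind _ K(1)] by blast
    have "insert x J \<in> indeps M" using x(2) by (rule I2) auto
    then show False using max[of "insert x J"] x(1) J(2) by blast
  qed
  have sub: "I \<union> (B - X) \<subseteq> ground M"
    using I X indep_subset_ground[OF basis_indep[OF B(1)]] by blast
  obtain K where K: "K \<in> indeps M" "I \<subseteq> K" "K \<subseteq> I \<union> (B - X)"
      "\<And>L. L \<in> indeps M \<Longrightarrow> K \<subseteq> L \<Longrightarrow> L \<subseteq> I \<union> (B - X) \<Longrightarrow> L = K"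
    using obtain_maximal_indep[OF I(1) _ sub] by blast
  have bK: "basis M K"
  proof (rule ccontr)
    assume "\<not> basis M K"
    then obtain x where x: "x \<in> B - K" "insert x K \<in> indeps M"
      using basis_exchange[OF K(1) _ B(1)] by blast
    have "insert x I \<in> indeps M" using x(2) by (rule I2) (use K in auto)
    moreover have "x \<notin> B - X" using K(4)[of "insert x K"] x K(3) by blast
    ultimately show False using none that[of x] x(1) BX K(2) by blast
  qed
  have KX: "K = I \<union> (B - X)" using full[OF bK] K I(2) by blast
  have "insert y K \<subseteq> ground M" using y X sub KX by blast
  then obtain L where L: "L \<in> indeps M" "insert y I \<subseteq> L" "L \<subseteq> insert y K"
      "\<And>N. N \<in> indeps M \<Longrightarrow> L \<subseteq> N \<Longrightarrow> N \<subseteq> insert y K \<Longrightarrow> N = L"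
    using obtain_maximal_indep[OF y(2)] K(2) by (metis insert_mono)
  have "basis M L"
  proof (rule ccontr)
    assume "\<not> basis M L"
    then obtain x where x: "x \<in> K - L" "insert x L \<in> indeps M"
      using basis_exchange[OF L(1) _ bK] by blast
    then show False using L(4)[of "insert x L"] L(3) by blast
  qed
  then have "L - X = B - X" using full[of L] L(3) KX I(2) y(1) by blast
  then have "L = insert y K" using L(2,3) KX by blast
  moreover have "y \<notin> K" using KX y(1) by blast
  ultimately show False using basis_maximal[OF bK L(1)] by blast
qed

text \<open>An infinite dependent set cannot in general be shrunk to a minimal one by removing
  elements one at a time. The circuit is instead the fundamental circuit of an element
  \<open>e\<close> over a maximal independent subset \<open>I\<close> of \<open>X\<close>.\<close>

lemma obtain_circuit:
  assumes X: "X \<subseteq> ground M" "X \<notin> indeps M"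
  obtains C where "circuit M C" "C \<subseteq> X"
proof -
  obtain I where I: "I \<in> indeps M" "I \<subseteq> X"
      "\<And>K. K \<in> indeps M \<Longrightarrow> I \<subseteq> K \<Longrightarrow> K \<subseteq> X \<Longrightarrow> K = I"
    using obtain_maximal_indep[OF I1 empty_subsetI X(1)] by metis
  have "I \<noteq> X" using I(1) X(2) by blast
  then obtain e where e: "e \<in> X - I" using I(2) by blast
  let ?X = "insert e I"
  have dep: "?X \<notin> indeps M" using I(2) I(3)[of ?X] e by blast
  have ground: "?X \<subseteq> ground M" using I(2) e X(1) by blast
  \<comment> \<open>Every circuit inside \<open>?X\<close> contains these elements; what needs proof
    is that they already form a dependent set.\<close>
  define C where "C = {x \<in> ?X. ?X - {x} \<in> indeps M}"
  have CX: "C \<subseteq> ?X" by (auto simp: C_def)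
  have "C \<notin> indeps M"
  proof
    assume "C \<in> indeps M"
    then obtain J where J: "J \<in> indeps M" "C \<subseteq> J" "J \<subseteq> ?X"
        "\<And>K. K \<in> indeps M \<Longrightarrow> J \<subseteq> K \<Longrightarrow> K \<subseteq> ?X \<Longrightarrow> K = J"
      using obtain_maximal_indep[OF _ CX ground] by metis
    have "?X - {e} = I" using e by auto
    then have "e \<in> C" using I(1) by (simp add: C_def)
    have "J \<noteq> ?X" using J(1) dep by metis
    then obtain z where z: "z \<in> ?X - J" using J(3) by auto
    then have zI: "z \<in> I" "z \<noteq> e" using \<open>e \<in> C\<close> J(2) by auto
    \<comment> \<open>Since \<open>z\<close> can be put back, \<open>I - {z}\<close> is not maximal
      in \<open>?X\<close>; \<open>J\<close> omits \<open>z\<close>, so the only element it can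
      contribute is \<open>e\<close>, which places \<open>z\<close> in \<open>C\<close>.\<close>
    obtain x where x: "x \<in> J - (I - {z})" "insert x (I - {z}) \<in> indeps M"
    proof (rule restricted_exchange[of "I - {z}" ?X J z])
      show "I - {z} \<in> indeps M" using I(1) by (rule I2) auto
      show "insert z (I - {z}) \<in> indeps M" using I(1) zI by (simp add: insert_absorb)
    qed (use ground J zI in auto)
    have "x = e" using x(1) z J(3) by auto
    then have "?X - {z} \<in> indeps M" using x(2) zI by (simp add: insert_Diff_if)
    then show False using z J(2) by (auto simp: C_def)
  qed
  moreover have "Y \<in> indeps M" if Y: "Y \<subset> C" for Y
  proof -
    obtain x where x: "x \<in> C" "Y \<subseteq> C - {x}" using Y by blast
    show ?thesis by (rule I2[of "?X - {x}"]) (use x in \<open>auto simp: C_def\<close>)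
  qed
  moreover have "C \<subseteq> ground M" using CX ground by (rule subset_trans)
  ultimately have "circuit M C"
    unfolding circuit_def minimal_in_def by (auto simp: psubset_eq)
  moreover have "C \<subseteq> X" using CX I(2) e by auto
  ultimately show ?thesis by (rule that)
qed

lemma indep_iff_no_circuit:
  "I \<in> indeps M \<longleftrightarrow> I \<subseteq> ground M \<and> (\<forall>C. circuit M C \<longrightarrow> \<not> C \<subseteq> I)"
  using obtain_circuit[of I] indep_subset_ground circuitD(2) I2 by metis

text \<open>Common core of orthogonality and of contraction. A maximal independent set
  \<open>K\<close> outside \<open>Z\<close> that contains \<open>C - {e}\<close> is a basis:
  exchange with a basis avoiding \<open>Z - {e}\<close> could only add \<open>e\<close>, which would
  complete \<open>C\<close>.\<close>

lemma coindep_insert_circuit: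
  assumes C: "circuit M C" "e \<in> C" and Z: "C \<inter> Z \<subseteq> {e}" "Z \<subseteq> ground M"
    and coind: "Z - {e} \<in> indeps (dual M)"
  shows "Z \<in> indeps (dual M)"
proof -
  obtain B where B: "basis M B" "(Z - {e}) \<inter> B = {}"
    using coind by (auto simp: indeps_dual_iff)
  have "C - {e} \<in> indeps M" using circuitD(3)[OF C(1)] C(2) by blast
  moreover have "C - {e} \<subseteq> ground M - Z" using Z(1) circuitD(1)[OF C(1)] by blast
  ultimately obtain K where K: "K \<in> indeps M" "C - {e} \<subseteq> K" "K \<subseteq> ground M - Z"
      "\<And>L. L \<in> indeps M \<Longrightarrow> K \<subseteq> L \<Longrightarrow> L \<subseteq> ground M - Z \<Longrightarrow> L = K"
    using obtain_maximal_indep[of "C - {e}" "ground M - Z"] by blast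
  have "basis M K"
  proof (rule ccontr)
    assume "\<not> basis M K"
    then obtain x where x: "x \<in> B - K" "insert x K \<in> indeps M"
      using basis_exchange[OF K(1) _ B(1)] by blast
    have "x \<in> Z" using K(4)[of "insert x K"] x K(3) indep_subset_ground[OF x(2)] by blast
    then have "C \<subseteq> insert x K" using x(1) B(2) K(2) by blast
    then show False using I2[OF x(2)] circuitD(2)[OF C(1)] by blast
  qed
  then show ?thesis using K(3) Z(2) by (auto simp: indeps_dual_iff)
qed

lemma circuit_cocircuit_not_singleton:
  assumes "circuit M C" "cocircuit M b"
  shows "C \<inter> b \<noteq> {e}"
proof
  assume *: "C \<inter> b = {e}"
  have b: "circuit (dual M) b" using assms(2) by (simp add: cocircuit_def)
  have "b - {e} \<in> indeps (dual M)" using circuitD(3)[OF b] * by blast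
  then have "b \<in> indeps (dual M)"
    using coindep_insert_circuit[OF assms(1), of e b] * circuitD(1)[OF b] by auto
  then show False using circuitD(2)[OF b] by simp
qed

text \<open>\<open>b\<close> is the complement of the closure of \<open>B - {e}\<close>. It is
  codependent because exchange takes an element of \<open>b\<close> from every basis, and minimal
  because replacing \<open>e\<close> in \<open>B\<close> by an element \<open>x\<close> of
  \<open>b\<close> gives a basis that meets \<open>b\<close> only in \<open>x\<close>.\<close>

lemma fundamental_cocircuit:
  assumes B: "basis M B" "e \<in> B"
  defines "b \<equiv> {x \<in> ground M. x \<notin> B - {e} \<and> insert x (B - {e}) \<in> indeps M}"
  shows "cocircuit M b" "e \<in> b"
proof -
  have Bg: "B \<subseteq> ground M" using indep_subset_ground[OF basis_indep[OF B(1)]] .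
  show eb: "e \<in> b"
    using B Bg basis_indep by (auto simp: b_def insert_absorb)
  have ind: "B - {e} \<in> indeps M" using I2[OF basis_indep[OF B(1)]] by blast
  have nb: "\<not> basis M (B - {e})"
    using basis_maximal[of "B - {e}" B] basis_indep[OF B(1)] B(2) by blast
  have dep: "b \<notin> indeps (dual M)"
  proof
    assume "b \<in> indeps (dual M)"
    then obtain B' where B': "basis M B'" "b \<inter> B' = {}" by (auto simp: indeps_dual_iff)
    obtain x where "x \<in> B' - (B - {e})" "insert x (B - {e}) \<in> indeps M"
      using basis_exchange[OF ind nb B'(1)] by blast
    then show False using B'(2) indep_subset_ground by (fastforce simp: b_def)
  qed
  have "b - {x} \<in> indeps (dual M)" if x: "x \<in> b" for x
  proof -
    have xind: "insert x (B - {e}) \<in> indeps M" and xB: "x \<notin> B - {e}" using x by (auto simp: b_def)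
    have "basis M (insert x (B - {e}))"
    proof (rule ccontr)
      assume nbx: "\<not> basis M (insert x (B - {e}))"
      then have "x \<noteq> e" using B by (auto simp: insert_absorb)
      obtain y where "y \<in> B - insert x (B - {e})" "insert y (insert x (B - {e})) \<in> indeps M"
        using basis_exchange[OF xind nbx B(1)] by blast
      then have "insert x B \<in> indeps M"
        using B(2) by (metis Diff_iff insert_Diff insert_commute insert_iff)
      then show False using basis_maximal[OF B(1)] xB \<open>x \<noteq> e\<close> by blast
    qed
    then show ?thesis by (auto simp: indeps_dual_iff b_def)
  qed
  then have "Y \<in> indeps (dual M)" if "Y \<subset> b" for Y
    using that unfolding indeps_dual_iff by blast
  then show "cocircuit M b"
    using dep unfolding cocircuit_def circuit_def minimal_in_def by (auto simp: b_def)
qed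

text \<open>Take a maximal independent subset \<open>I\<close> of \<open>P\<close>. If
  \<open>insert e I\<close> is dependent, it contains a circuit through \<open>e\<close>; otherwise
  it extends to a basis, and the fundamental cocircuit of \<open>e\<close> avoids \<open>P\<close>,
  since an element of \<open>P\<close> in it could be added to \<open>I\<close>.\<close>

lemma circuit_or_cocircuit:
  assumes "ground M = insert e (P \<union> Q)" "e \<notin> P" "P \<inter> Q = {}"
  obtains (circuit) C where "circuit M C" "e \<in> C" "C \<subseteq> insert e P"
    | (cocircuit) b where "cocircuit M b" "e \<in> b" "b \<subseteq> insert e Q"
proof -
  have P: "P \<subseteq> ground M" using assms(1) by auto
  obtain I where I: "I \<in> indeps M" "I \<subseteq> P"
      "\<And>K. K \<in> indeps M \<Longrightarrow> I \<subseteq> K \<Longrightarrow> K \<subseteq> P \<Longrightarrow> K = I"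
    using obtain_maximal_indep[OF I1 empty_subsetI P] by metis
  show ?thesis
  proof (cases "insert e I \<in> indeps M")
    case False
    moreover have "insert e I \<subseteq> ground M" using assms(1) I(2) P by simp
    ultimately obtain C where C: "circuit M C" "C \<subseteq> insert e I"
      using obtain_circuit by metis
    then have "e \<in> C" using I2[OF I(1)] circuitD(2) by blast
    then show ?thesis using circuit C I(2) by blast
  next
    case True
    then obtain B where B: "basis M B" "insert e I \<subseteq> B" by (rule obtain_basis)
    let ?b = "{x \<in> ground M. x \<notin> B - {e} \<and> insert x (B - {e}) \<in> indeps M}"
    have "?b \<subseteq> insert e Q"
    proof
      fix x assume x: "x \<in> ?b"
      have "x \<notin> P"
      proof
        assume "x \<in> P"
        have "insert x I \<in> indeps M"
          by (rule I2[of "insert x (B - {e})"]) (use x B(2) I(2) assms(2) in auto)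
        then have "x \<in> I" using I(2,3) \<open>x \<in> P\<close> by blast
        then show False using x B(2) assms(2) \<open>x \<in> P\<close> by blast
      qed
      then show "x \<in> insert e Q" using x assms(1) by simp
    qed
    moreover have "e \<in> B" using B(2) by simp
    ultimately show ?thesis using cocircuit[of ?b] fundamental_cocircuit[OF B(1)] by blast
  qed
qed

text \<open>In \<open>circuit_or_cocircuit\<close> with \<open>C - {e, f}\<close> as
  \<open>P\<close>, a circuit inside \<open>C - {f}\<close> is impossible. So there is a cocircuit
  through \<open>e\<close> that meets \<open>C\<close> inside \<open>{e, f}\<close>, and it cannot
  meet \<open>C\<close> in \<open>e\<close> alone.\<close>

lemma cocircuit_through_pair:
  assumes C: "circuit M C" "e \<in> C" "f \<in> C" "e \<noteq> f"
  obtains b where "cocircuit M b" "C \<inter> b = {e, f}"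
proof (rule circuit_or_cocircuit[of e "C - {e, f}" "insert f (ground M - C)"])
  show "ground M = insert e (C - {e, f} \<union> insert f (ground M - C))"
    using C circuitD(1)[OF C(1)] by blast
next
  fix C' assume "circuit M C'" "e \<in> C'" "C' \<subseteq> insert e (C - {e, f})"
  then show thesis using circuit_subset_eq[of M C' C] C by blast
next
  fix b assume b: "cocircuit M b" "e \<in> b" "b \<subseteq> insert e (insert f (ground M - C))"
  then have "C \<inter> b = {e} \<or> C \<inter> b = {e, f}" using C(2,3) by blast
  then show thesis using circuit_cocircuit_not_singleton[OF C(1) b(1), of e] that[OF b(1)] by blast
qed (use C in auto)

lemma circuit_through_pair:
  assumes b: "cocircuit M b" "e \<in> b" "f \<in> b" "e \<noteq> f"
  obtains C where "circuit M C" "C \<inter> b = {e, f}"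
proof (rule circuit_or_cocircuit[of e "insert f (ground M - b)" "b - {e, f}"])
  show "ground M = insert e (insert f (ground M - b) \<union> (b - {e, f}))"
    using b cocircuit_subset_ground[OF b(1)] by blast
next
  fix b' assume "cocircuit M b'" "e \<in> b'" "b' \<subseteq> insert e (b - {e, f})"
  then show thesis using circuit_subset_eq[of "dual M" b' b] b unfolding cocircuit_def by blast
next
  fix C assume C: "circuit M C" "e \<in> C" "C \<subseteq> insert e (insert f (ground M - b))"
  then have "C \<inter> b = {e} \<or> C \<inter> b = {e, f}" using b(2,3) by blast
  then show thesis using circuit_cocircuit_not_singleton[OF C(1) b(1), of e] that[OF C(1)] by blast
qed (use b in auto)

section \<open>Independent sets of contractions and minors\<close>

lemma indeps_contract_unfold:
  "I \<in> indeps (contract M C) \<longleftrightarrow> (\<exists>B. basis (delete (dual M) C) B \<and> I \<subseteq> ground M - C - B)"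
  by (simp add: contract_def dual_def[of "delete (dual M) C"]) (simp add: delete_def)

text \<open>Replaces the double dual in \<open>contract\<close> by a condition on circuits of
  \<open>M\<close>. Forwards, an element of \<open>X \<inter> I\<close> could be added to the
  maximal coindependent set \<open>B'\<close> by \<open>coindep_insert_circuit\<close>. Backwards,
  \<open>I\<close> together with a maximal independent subset \<open>J\<close> of \<open>C\<close>
  contains no circuit and extends to a basis.\<close>

lemma indeps_contract_iff:
  assumes "C \<subseteq> ground M"
  shows "I \<in> indeps (contract M C) \<longleftrightarrow>
    I \<subseteq> ground M - C \<and> (\<forall>X. circuit M X \<longrightarrow> X \<subseteq> I \<union> C \<longrightarrow> X \<inter> I = {})"
    (is "_ \<longleftrightarrow> ?R")
proof
  assume "I \<in> indeps (contract M C)"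
  then obtain B' where B': "basis (delete (dual M) C) B'" and I: "I \<subseteq> ground M - C - B'"
    by (auto simp: indeps_contract_unfold)
  have B'ind: "B' \<in> indeps (dual M)" "B' \<inter> C = {}"
    and B'max: "\<And>Y. Y \<in> indeps (dual M) \<Longrightarrow> Y \<inter> C = {} \<Longrightarrow> B' \<subseteq> Y \<Longrightarrow> Y = B'"
    using B' by (auto simp: basis_def maximal_in_def delete_def)
  have "X \<inter> I = {}" if X: "circuit M X" "X \<subseteq> I \<union> C" for X
  proof (rule ccontr)
    assume "X \<inter> I \<noteq> {}"
    then obtain e where e: "e \<in> X" "e \<in> I" by blast
    have "insert e B' \<in> indeps (dual M)"
    proof (rule coindep_insert_circuit[OF X(1) e(1)])
      show "X \<inter> insert e B' \<subseteq> {e}" using X(2) I B'ind(2) by blast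
      show "insert e B' \<subseteq> ground M" using e(2) I B'ind(1) by (auto simp: indeps_dual_iff)
      show "insert e B' - {e} \<in> indeps (dual M)" using B'ind(1) by (auto simp: indeps_dual_iff)
    qed
    then show False using B'max[of "insert e B'"] B'ind(2) e(2) I by blast
  qed
  then show ?R using I by blast
next
  assume R: ?R
  obtain J where J: "J \<in> indeps M" "J \<subseteq> C"
      "\<And>K. K \<in> indeps M \<Longrightarrow> J \<subseteq> K \<Longrightarrow> K \<subseteq> C \<Longrightarrow> K = J"
    using obtain_maximal_indep[OF I1 empty_subsetI assms] by metis
  have "\<not> X \<subseteq> I \<union> J" if "circuit M X" for X
  proof
    assume "X \<subseteq> I \<union> J"
    moreover have "X \<subseteq> I \<union> C" using calculation J(2) by blast
    ultimately have "X \<subseteq> J" using R that by blast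
    then show False using I2[OF J(1)] circuitD(2)[OF that] by blast
  qed
  then have "I \<union> J \<in> indeps M"
    unfolding indep_iff_no_circuit using R J(2) assms by blast
  then obtain B where B: "basis M B" "I \<union> J \<subseteq> B" by (rule obtain_basis)
  let ?B' = "ground M - C - B"
  \<comment> \<open>A larger \<open>Y\<close> contains some \<open>e\<close> of \<open>B\<close>.
    Exchanging \<open>e\<close> against a basis disjoint from \<open>Y\<close> yields an element of
    \<open>C - B\<close>, which could have been added to \<open>J\<close>.\<close>
  have "Y = ?B'" if Y: "Y \<in> indeps (dual M)" "Y \<inter> C = {}" "?B' \<subseteq> Y" for Y
  proof (rule ccontr)
    assume "Y \<noteq> ?B'"
    obtain B2 where B2: "basis M B2" "Y \<inter> B2 = {}" "Y \<subseteq> ground M"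
      using Y(1) by (auto simp: indeps_dual_iff)
    obtain e where e: "e \<in> Y" "e \<in> B" "e \<notin> C" using \<open>Y \<noteq> ?B'\<close> Y(2,3) B2(3) by blast
    have ind: "B - {e} \<in> indeps M" using I2[OF basis_indep[OF B(1)]] by blast
    have nb: "\<not> basis M (B - {e})"
      using basis_maximal[of "B - {e}" B] basis_indep[OF B(1)] e(2) by blast
    obtain x where x: "x \<in> B2 - (B - {e})" "insert x (B - {e}) \<in> indeps M"
      using basis_exchange[OF ind nb B2(1)] by blast
    have xC: "x \<in> C" "x \<notin> B"
      using x(1) e(1) B2 Y(3) indep_subset_ground[OF basis_indep[OF B2(1)]] by blast+
    have "insert x J \<in> indeps M" by (rule I2[OF x(2)]) (use J(2) B(2) e(3) in auto)
    then have "x \<in> J" using J(2,3) xC(1) by blast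
    then show False using xC(2) B(2) by blast
  qed
  moreover have "?B' \<in> indeps (dual M)" using B(1) by (auto simp: indeps_dual_iff)
  ultimately have "basis (delete (dual M) C) ?B'"
    unfolding basis_def maximal_in_def by (auto simp: delete_def)
  then show "I \<in> indeps (contract M C)"
    using R B(2) unfolding indeps_contract_unfold by blast
qed

lemma indeps_minor_iff:
  assumes "C \<subseteq> ground M"
  shows "I \<in> indeps (delete (contract M C) D) \<longleftrightarrow>
    I \<subseteq> ground M - C - D \<and> (\<forall>X. circuit M X \<longrightarrow> X \<subseteq> I \<union> C \<longrightarrow> X \<inter> I = {})"
  using indeps_contract_iff[OF assms, of I] by (auto simp: delete_def)

end

lemma ground_minor: "ground (delete (contract M C) D) = ground M - C - D"
  by (simp add: delete_def contract_def)

section \<open>Compactness\<close>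

text \<open>By Tychonoff the product of finite discrete spaces is compact, and a constraint that
  depends on finitely many variables defines a closed set; the finite intersection property gives a
  common solution.\<close>

lemma finitary_constraints_compactness:
  fixes \<P> :: "(('v \<Rightarrow> 'a::finite) \<Rightarrow> bool) set"
  assumes finitary: "\<And>P. P \<in> \<P> \<Longrightarrow> \<exists>V. finite V \<and> (\<forall>f g. (\<forall>v\<in>V. f v = g v) \<longrightarrow> P f \<longrightarrow> P g)"
    and satisfiable: "\<And>\<F>. finite \<F> \<Longrightarrow> \<F> \<subseteq> \<P> \<Longrightarrow> \<exists>f. \<forall>P\<in>\<F>. P f"
  shows "\<exists>f. \<forall>P\<in>\<P>. P f"
proof -
  define T where "T = product_topology (\<lambda>_::'v. discrete_topology (UNIV :: 'a set)) UNIV"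
  have [simp]: "topspace T = UNIV" by (simp add: T_def)
  have "compact_space T"
    unfolding T_def by (simp add: compact_space_product_topology compact_space_discrete_topology)
  have closed: "closedin T (Collect P)" if P: "P \<in> \<P>" for P
  proof -
    obtain V where V: "finite V" "\<And>f g. (\<forall>v\<in>V. f v = g v) \<Longrightarrow> P f \<Longrightarrow> P g"
      using finitary[OF P] by blast
    have "openin T {f. \<not> P f}"
      unfolding T_def openin_product_topology_alt
    proof (intro ballI)
      fix f assume f: "f \<in> {f. \<not> P f}"
      let ?U = "\<lambda>v. if v \<in> V then {f v} else UNIV"
      have "{v. ?U v \<noteq> UNIV} \<subseteq> V" by auto
      then have "finite {v. ?U v \<noteq> UNIV}" using V(1) finite_subset by blast
      moreover have "g \<in> {f. \<not> P f}" if "g \<in> Pi\<^sub>E UNIV ?U" for g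
      proof -
        have "\<forall>v\<in>V. g v = f v" using that by (auto simp: PiE_iff split: if_splits)
        then show ?thesis using V(2)[of g f] f by auto
      qed
      ultimately show "\<exists>U. finite {v \<in> UNIV. U v \<noteq> topspace (discrete_topology UNIV)} \<and>
          (\<forall>v\<in>UNIV. openin (discrete_topology UNIV) (U v)) \<and> f \<in> Pi\<^sub>E UNIV U \<and>
          Pi\<^sub>E UNIV U \<subseteq> {f. \<not> P f}"
        by (intro exI[of _ ?U]) (auto simp: PiE_iff)
    qed
    then show ?thesis by (simp add: closedin_def Collect_neg_eq Compl_eq_Diff_UNIV)
  qed
  have "\<Inter>(Collect ` \<P>) \<noteq> {}"
  proof -
    have "\<Inter>\<F> \<noteq> {}" if \<F>: "finite \<F>" "\<F> \<subseteq> Collect ` \<P>" for \<F>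
    proof -
      obtain \<G> where \<G>: "finite \<G>" "\<G> \<subseteq> \<P>" "\<F> = Collect ` \<G>"
        using finite_subset_image[OF \<F>] by blast
      then obtain f where "\<forall>P\<in>\<G>. P f" using satisfiable by blast
      then show ?thesis using \<G>(3) by blast
    qed
    moreover have "\<forall>U\<in>Collect ` \<P>. closedin T U" using closed by blast
    ultimately show ?thesis
      using \<open>compact_space T\<close>[unfolded compact_space_fip, rule_format, of "Collect ` \<P>"] by simp
  qed
  then show ?thesis by auto
qed

section \<open>Thin dependences\<close>

text \<open>Turns thin sums into finite sums. \<open>T\<close> may exceed the support, which allows
  a common index set for two families, or all of \<open>C \<inter> b\<close> when it is
  finite.\<close>

lemma thin_sum_zero_iff_sum:
  assumes "finite T" "T \<subseteq> S" "\<And>e. e \<in> S - T \<Longrightarrow> g e = 0"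
  shows "thin_sum_zero S g \<longleftrightarrow> sum g T = 0"
proof -
  have sub: "{e \<in> S. g e \<noteq> 0} \<subseteq> T" using assms(3) by blast
  moreover have "sum g {e \<in> S. g e \<noteq> 0} = sum g T"
    by (rule sum.mono_neutral_left) (use assms sub in auto)
  ultimately show ?thesis
    using assms(1) finite_subset unfolding thin_sum_zero_def by auto
qed

lemma thin_sum_zero_cong:
  assumes "\<And>e. e \<in> S \<Longrightarrow> g e = h e"
  shows "thin_sum_zero S g \<longleftrightarrow> thin_sum_zero S h"
proof -
  have "{e \<in> S. g e \<noteq> 0} = {e \<in> S. h e \<noteq> 0}" using assms by auto
  moreover from this have "sum g {e \<in> S. g e \<noteq> 0} = sum h {e \<in> S. h e \<noteq> 0}"
    by (intro sum.cong) (auto simp: assms)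
  ultimately show ?thesis by (simp add: thin_sum_zero_def)
qed

lemma thin_sum_zero_add:
  assumes "thin_sum_zero S g" "thin_sum_zero S h"
  shows "thin_sum_zero S (\<lambda>e. g e + h e)"
proof -
  let ?T = "{e \<in> S. g e \<noteq> 0} \<union> {e \<in> S. h e \<noteq> 0}"
  have fin: "finite ?T" using assms by (simp add: thin_sum_zero_def)
  have "sum g ?T = 0"
    by (rule iffD1[OF thin_sum_zero_iff_sum assms(1)]) (use fin in auto)
  moreover have "sum h ?T = 0"
    by (rule iffD1[OF thin_sum_zero_iff_sum assms(2)]) (use fin in auto)
  ultimately show ?thesis
    by (subst thin_sum_zero_iff_sum[of ?T]) (use fin in \<open>auto simp: sum.distrib\<close>)
qed

lemma thin_sum_zero_scale:
  assumes "thin_sum_zero S g"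
  shows "thin_sum_zero S (\<lambda>e. c * g e)"
  using assms
  by (subst thin_sum_zero_iff_sum[of "{e \<in> S. g e \<noteq> 0}"])
    (auto simp: thin_sum_zero_def simp flip: sum_distrib_left)

section \<open>Linear combinations of thin dependences and dependences supported on circuits\<close>

lemma thin_dependence_add:
  "thin_dependence E A f l \<Longrightarrow> thin_dependence E A f l' \<Longrightarrow> thin_dependence E A f (\<lambda>e. l e + l' e)"
  unfolding thin_dependence_def using thin_sum_zero_add by (fastforce simp: distrib_right)

lemma thin_dependence_scale:
  "thin_dependence E A f l \<Longrightarrow> thin_dependence E A f (\<lambda>e. c * l e)"
  unfolding thin_dependence_def using thin_sum_zero_scale by (fastforce simp: mult.assoc)

lemma thin_dependence_lincomb:
  assumes "finite J" "\<And>j. j \<in> J \<Longrightarrow> thin_dependence E A f (h j)"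
  shows "thin_dependence E A f (\<lambda>e. \<Sum>j\<in>J. u j * h j e)"
  using assms
proof (induction J rule: finite_induct)
  case empty
  then show ?case by (simp add: thin_dependence_def thin_sum_zero_def)
next
  case (insert j J)
  then show ?case
    using thin_dependence_add[OF thin_dependence_scale[of E A f "h j" "u j"]] by auto
qed

lemma thin_dependence_diff_lincomb:
  assumes "thin_dependence E A f l" "finite J" "\<And>j. j \<in> J \<Longrightarrow> thin_dependence E A f (h j)"
  shows "thin_dependence E A f (\<lambda>e. l e - (\<Sum>j\<in>J. u j * h j e))"
  using thin_dependence_add[OF assms(1)
      thin_dependence_scale[OF thin_dependence_lincomb[where u = u, OF assms(2,3)], where c = "-1"]]
  by simp

lemma thin_dependence_cong:
  assumes "\<And>e. e \<in> E \<Longrightarrow> l e = l' e"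
  shows "thin_dependence E A f l \<longleftrightarrow> thin_dependence E A f l'"
  unfolding thin_dependence_def by (intro ball_cong refl thin_sum_zero_cong) (simp add: assms)

text \<open>A non-zero thin dependence that vanishes off \<open>C\<close> has a dependent support,
  which by minimality of \<open>C\<close> is all of \<open>C\<close>.\<close>

lemma circuit_thin_dependence:
  assumes rep: "thin_represents A f M" and C: "circuit M C"
  obtains l where "thin_dependence (ground M) A f l" "\<And>e. l e \<noteq> 0 \<longleftrightarrow> e \<in> C"
proof -
  have "\<not> thinly_independent (ground M) A f C"
    using circuitD(2)[OF C] rep by (auto simp: thin_represents_def)
  then obtain l e0 where l: "thin_dependence (ground M) A f l" "\<forall>e\<in>ground M - C. l e = 0"
      "e0 \<in> ground M" "l e0 \<noteq> 0"
    using circuitD(1)[OF C] by (auto simp: thinly_independent_def)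
  let ?S = "{e \<in> ground M. l e \<noteq> 0}"
  \<comment> \<open>\<open>thin_dependence\<close> ignores values outside the ground set, whereas
    the conclusion concerns all \<open>e\<close>; hence the cut-off.\<close>
  let ?l = "\<lambda>e. if e \<in> ground M then l e else 0"
  have "\<not> thinly_independent (ground M) A f ?S"
    using l by (auto simp: thinly_independent_def)
  then have "?S \<notin> indeps M" using rep by (simp add: thin_represents_def)
  moreover have "?S \<subseteq> C" using l(2) by blast
  ultimately have "?S = C" using circuitD(3)[OF C, of ?S] by blast
  moreover have "thin_dependence (ground M) A f ?l"
    using l(1) thin_dependence_cong[of "ground M" l ?l A f] by simp
  ultimately show ?thesis using that[of ?l] by auto
qed

context matroid
begin

text \<open>On the support of \<open>l\<close> every coordinate \<open>f _ a\<close> has finite support, so there the thin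
  dependences form a closed set and compactness applies although thinness is not a closed
  condition on all of the ground set.\<close>

lemma thin_dependence_contains_circuit:
  fixes f :: "'e \<Rightarrow> 'a \<Rightarrow> 'k::{field,finite}"
  assumes rep: "thin_represents A f M" and l: "thin_dependence (ground M) A f l"
    and e0: "e0 \<in> ground M" "l e0 \<noteq> 0"
  obtains C where "circuit M C" "e0 \<in> C" "C \<subseteq> {e \<in> ground M. l e \<noteq> 0}"
proof -
  let ?E = "ground M"
  define S where "S = {e \<in> ?E. l e \<noteq> 0}"
  have SE: "S - {e0} \<subseteq> ?E" "S \<subseteq> ?E" by (auto simp: S_def)
  obtain I where I: "I \<in> indeps M" "I \<subseteq> S - {e0}"
      "\<And>K. K \<in> indeps M \<Longrightarrow> I \<subseteq> K \<Longrightarrow> K \<subseteq> S - {e0} \<Longrightarrow> K = I"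
    using obtain_maximal_indep[OF I1 empty_subsetI SE(1)] by metis
  define X where "X = S - {e0} - I"
  \<comment> \<open>The fundamental circuit of \<open>x\<close> over \<open>I\<close>, scaled to 1
    at \<open>x\<close>: subtracting a multiple clears \<open>x\<close> without touching
    \<open>e0\<close> or other elements of \<open>X\<close>.\<close>
  have "\<exists>h. thin_dependence ?E A f h \<and> h x = 1 \<and> (\<forall>e. h e \<noteq> 0 \<longrightarrow> e \<in> insert x I)"
    if x: "x \<in> X" for x
  proof -
    have "insert x I \<notin> indeps M" "insert x I \<subseteq> ?E"
      using I(2) I(3)[of "insert x I"] x SE by (auto simp: X_def)
    then obtain C where C: "circuit M C" "C \<subseteq> insert x I" by (metis obtain_circuit)
    then have "x \<in> C" using I2[OF I(1), of C] circuitD(2) by blast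
    obtain h where h: "thin_dependence ?E A f h" "\<And>e. h e \<noteq> 0 \<longleftrightarrow> e \<in> C"
      using circuit_thin_dependence[OF rep C(1)] by blast
    show ?thesis
      by (rule exI[of _ "\<lambda>e. inverse (h x) * h e"])
        (use h C(2) \<open>x \<in> C\<close> thin_dependence_scale[OF h(1)] in auto)
  qed
  then obtain h where h: "\<And>x. x \<in> X \<Longrightarrow> thin_dependence ?E A f (h x)" "\<And>x. x \<in> X \<Longrightarrow> h x x = 1"
      "\<And>x e. x \<in> X \<Longrightarrow> h x e \<noteq> 0 \<Longrightarrow> e \<in> insert x I"
    by metis
  define T where "T a = {e \<in> S. f e a \<noteq> 0}" for a
  have finT: "finite (T a)" if "a \<in> A" for a
  proof -
    have "T a = {e \<in> ?E. l e * f e a \<noteq> 0}" by (auto simp: T_def S_def)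
    then show ?thesis using l that by (auto simp: thin_dependence_def thin_sum_zero_def)
  qed
  have thin_on_S: "thin_dependence ?E A f g \<longleftrightarrow> (\<forall>a\<in>A. (\<Sum>e\<in>T a. g e * f e a) = 0)"
    if "\<And>e. e \<notin> S \<Longrightarrow> g e = 0" for g
    unfolding thin_dependence_def
    by (intro ball_cong refl thin_sum_zero_iff_sum finT) (use that in \<open>auto simp: T_def S_def\<close>)
  define \<Z> where "\<Z> = (\<lambda>x (g :: 'e \<Rightarrow> 'k). g x = 0) ` X"
  define \<O> where "\<O> = (\<lambda>x (g :: 'e \<Rightarrow> 'k). g x = 0) ` (- S)"
  define \<D> where "\<D> = (\<lambda>a (g :: 'e \<Rightarrow> 'k). (\<Sum>e\<in>T a. g e * f e a) = 0) ` A"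
  \<comment> \<open>A solution is a thin dependence supported in \<open>insert e0 I\<close> with
    value \<open>l e0\<close> at \<open>e0\<close>; it makes \<open>insert e0 I\<close> dependent,
    so a circuit in it must use \<open>e0\<close>.\<close>
  have "\<exists>g. \<forall>P \<in> insert (\<lambda>g. g e0 = l e0) (\<Z> \<union> \<O> \<union> \<D>). P g"
  proof (rule finitary_constraints_compactness)
    fix P assume "P \<in> insert (\<lambda>g. g e0 = l e0) (\<Z> \<union> \<O> \<union> \<D>)"
    then consider x where "P = (\<lambda>g. g x = 0)" | "P = (\<lambda>g. g e0 = l e0)"
      | a where "a \<in> A" "P = (\<lambda>g. (\<Sum>e\<in>T a. g e * f e a) = 0)"
      by (auto simp: \<Z>_def \<O>_def \<D>_def)
    then show "\<exists>V. finite V \<and> (\<forall>g g'. (\<forall>v\<in>V. g v = g' v) \<longrightarrow> P g \<longrightarrow> P g')"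
    proof cases
      case (1 x)
      then show ?thesis by (intro exI[of _ "{x}"]) simp
    next
      case 2
      then show ?thesis by (intro exI[of _ "{e0}"]) simp
    next
      case (3 a)
      then show ?thesis by (intro exI[of _ "T a"]) (simp add: finT)
    qed
  next
    fix \<F> assume \<F>: "finite \<F>" "\<F> \<subseteq> insert (\<lambda>g. g e0 = l e0) (\<Z> \<union> \<O> \<union> \<D>)"
    have "finite (\<F> \<inter> \<Z>)" "\<F> \<inter> \<Z> \<subseteq> (\<lambda>x (g :: 'e \<Rightarrow> 'k). g x = 0) ` X"
      using \<F>(1) by (auto simp: \<Z>_def)
    then obtain X0 where X0: "X0 \<subseteq> X" "finite X0" "\<F> \<inter> \<Z> = (\<lambda>x (g :: 'e \<Rightarrow> 'k). g x = 0) ` X0"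
      using finite_subset_image by meson
    \<comment> \<open>Finitely many constraints from \<open>\<Z>\<close> name only finitely many
      elements of \<open>X\<close>, so a finite combination clears them and stays a thin
      dependence.\<close>
    define g where "g e = (if e \<in> ?E then l e else 0) - (\<Sum>x\<in>X0. l x * h x e)" for e
    have offS: "g e = 0" if "e \<notin> S" for e
    proof -
      have "h x e = 0" if "x \<in> X0" for x
        using h(3)[of x e] that X0(1) I(2) \<open>e \<notin> S\<close> by (auto simp: X_def)
      then show ?thesis using that by (auto simp: g_def S_def)
    qed
    have "thin_dependence ?E A f (\<lambda>e. if e \<in> ?E then l e else 0)"
      using l thin_dependence_cong[of ?E l "\<lambda>e. if e \<in> ?E then l e else 0" A f] by simp
    then have "thin_dependence ?E A f g"
      unfolding g_def by (rule thin_dependence_diff_lincomb) (use X0 h(1) in auto)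
    then have gD: "P g" if "P \<in> \<D>" for P using thin_on_S[OF offS] that by (auto simp: \<D>_def)
    have ge0: "g e0 = l e0"
    proof -
      have "h x e0 = 0" if "x \<in> X0" for x
        using h(3)[of x e0] that X0(1) I(2) by (auto simp: X_def)
      then show ?thesis using e0(1) by (simp add: g_def)
    qed
    have gX0: "g y = 0" if "y \<in> X0" for y
    proof -
      have "h x y = (if x = y then 1 else 0)" if "x \<in> X0" for x
        using h(2,3)[of x] that X0(1) \<open>y \<in> X0\<close> by (auto simp: X_def)
      then have "(\<Sum>x\<in>X0. l x * h x y) = (\<Sum>x\<in>X0. if x = y then l y else 0)"
        by (intro sum.cong) auto
      then show ?thesis using that X0 SE by (auto simp: g_def X_def)
    qed
    have "P g" if P: "P \<in> \<F>" for P
    proof -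
      consider "P = (\<lambda>g. g e0 = l e0)" | "P \<in> \<F> \<inter> \<Z>" | "P \<in> \<O>" | "P \<in> \<D>"
        using subsetD[OF \<F>(2) P] P by (elim insertE UnE) simp_all
      then show ?thesis
      proof cases
        case 2
        then show ?thesis unfolding X0(3) using gX0 by auto
      next
        case 3
        then show ?thesis using offS by (auto simp: \<O>_def)
      qed (simp_all add: ge0 gD)
    qed
    then show "\<exists>g. \<forall>P\<in>\<F>. P g" by blast
  qed
  then obtain g where all: "\<forall>P \<in> insert (\<lambda>g. g e0 = l e0) (\<Z> \<union> \<O> \<union> \<D>). P g" ..
  have g: "g e0 = l e0" "\<And>x. x \<in> X \<Longrightarrow> g x = 0" "\<And>x. x \<notin> S \<Longrightarrow> g x = 0"
      "\<And>a. a \<in> A \<Longrightarrow> (\<Sum>e\<in>T a. g e * f e a) = 0"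
    using all by (simp_all add: \<Z>_def \<O>_def \<D>_def ball_Un)
  have "thin_dependence ?E A f g" using thin_on_S[of g] g(3,4) by blast
  moreover have "\<forall>e\<in>?E - insert e0 I. g e = 0" using g(2,3) by (auto simp: X_def)
  ultimately have "\<forall>e\<in>?E. g e = 0" if "thinly_independent ?E A f (insert e0 I)"
    using that unfolding thinly_independent_def by blast
  then have "insert e0 I \<notin> indeps M" using g(1) e0 rep by (auto simp: thin_represents_def)
  moreover have "insert e0 I \<subseteq> ?E" using I(2) SE e0(1) by auto
  ultimately obtain C where C: "circuit M C" "C \<subseteq> insert e0 I" by (metis obtain_circuit)
  then have "e0 \<in> C" using I2[OF I(1), of C] circuitD(2) by blast
  then show ?thesis using that[OF C(1)] C(2) I(2) e0 by (auto simp: S_def)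
qed

section \<open>Between thin sums representations and paintings\<close>

lemma cocircuit_nonempty:
  assumes "cocircuit M b"
  shows "b \<noteq> {}"
proof -
  obtain B where "basis M B" using obtain_basis[OF I1] by blast
  then have "{} \<in> indeps (dual M)" by (auto simp: indeps_dual_iff)
  then show ?thesis using circuitD(2)[of "dual M" b] assms by (auto simp: cocircuit_def)
qed

text \<open>For a cocircuit \<open>b\<close> with base point \<open>e0\<close>, the value \<open>d e\<close> is forced by orthogonality with a
  circuit meeting \<open>b\<close> in \<open>{e0, e}\<close>. Subtracting multiples of these circuits from an arbitrary
  circuit leaves a thin dependence that meets \<open>b\<close> at most in \<open>e0\<close>.\<close>

lemma cocircuit_vector:
  fixes f :: "'e \<Rightarrow> 'a \<Rightarrow> 'k::{field,finite}"
  assumes tame: "tame M" and rep: "thin_represents A f M" and b: "cocircuit M b"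
    and c: "\<And>C. circuit M C \<Longrightarrow> thin_dependence (ground M) A f (c C)"
      "\<And>C e. circuit M C \<Longrightarrow> c C e \<noteq> 0 \<longleftrightarrow> e \<in> C"
  obtains d where "\<And>e. e \<in> b \<Longrightarrow> d e \<noteq> 0"
    "\<And>C. circuit M C \<Longrightarrow> thin_sum_zero (C \<inter> b) (\<lambda>e. c C e * d e)"
proof -
  let ?E = "ground M"
  obtain e0 where e0: "e0 \<in> b" using cocircuit_nonempty[OF b] by blast
  have "\<exists>C. circuit M C \<and> C \<inter> b = {e0, e}" if "e \<in> b - {e0}" for e
    using circuit_through_pair[OF b e0, of e] that by blast
  then obtain D where D: "\<And>e. e \<in> b - {e0} \<Longrightarrow> circuit M (D e)"
      "\<And>e. e \<in> b - {e0} \<Longrightarrow> D e \<inter> b = {e0, e}"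
    by metis
  define h where "h e x = c (D e) x / c (D e) e" for e x
  have h: "thin_dependence ?E A f (h e)" "h e e = 1" "h e e0 \<noteq> 0"
      "\<And>x. x \<in> b - {e0} \<Longrightarrow> x \<noteq> e \<Longrightarrow> h e x = 0" if e: "e \<in> b - {e0}" for e
  proof -
    show "thin_dependence ?E A f (h e)"
      using thin_dependence_scale[OF c(1)[OF D(1)[OF e]], of "inverse (c (D e) e)"]
      by (simp add: h_def[abs_def] field_simps)
    show "h e e = 1" "h e e0 \<noteq> 0" using c(2)[OF D(1)[OF e]] D(2)[OF e] by (auto simp: h_def)
    show "h e x = 0" if "x \<in> b - {e0}" "x \<noteq> e" for x
      using c(2)[OF D(1)[OF e]] D(2)[OF e] that by (auto simp: h_def)
  qed
  define d where "d e = (if e = e0 then 1 else - h e e0)" for e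
  have "thin_sum_zero (C \<inter> b) (\<lambda>e. c C e * d e)" if C: "circuit M C" for C
  proof -
    define T where "T = C \<inter> b - {e0}"
    have fin: "finite (C \<inter> b)" "finite T" using tame C b by (auto simp: tame_def T_def)
    define g where "g x = c C x - (\<Sum>e\<in>T. c C e * h e x)" for x
    have "thin_dependence ?E A f g"
      unfolding g_def by (rule thin_dependence_diff_lincomb[OF c(1)[OF C] fin(2)])
        (use h(1) in \<open>auto simp: T_def\<close>)
    moreover have g0: "g x = 0" if x: "x \<in> b - {e0}" for x
    proof -
      have "(\<Sum>e\<in>T. c C e * h e x) = (\<Sum>e\<in>T. if e = x then c C x else 0)"
        by (rule sum.cong[OF refl]) (use h(2,4) x in \<open>auto simp: T_def\<close>)
      also have "\<dots> = c C x" using fin(2) x c(2)[OF C, of x] by (auto simp: T_def)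
      finally show ?thesis by (simp add: g_def)
    qed
    \<comment> \<open>The sum to be shown zero is the only value of \<open>g\<close> on
      \<open>b\<close> that could survive. Were it non-zero, a circuit through \<open>e0\<close> in
      the support of \<open>g\<close> would meet \<open>b\<close> in \<open>e0\<close>
      alone.\<close>
    moreover have "g e0 = (\<Sum>e\<in>C \<inter> b. c C e * d e)"
    proof -
      have "(\<Sum>e\<in>C \<inter> b. c C e * d e) = (\<Sum>e\<in>insert e0 T. c C e * d e)"
        by (rule sum.mono_neutral_left) (use fin c(2)[OF C] e0 in \<open>auto simp: T_def\<close>)
      also have "\<dots> = c C e0 + (\<Sum>e\<in>T. - (c C e * h e e0))"
        using fin(2) by (subst sum.insert) (auto simp: T_def d_def intro!: sum.cong)
      finally show ?thesis by (simp add: g_def sum_negf)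
    qed
    moreover have "g e0 = 0"
    proof (rule ccontr)
      assume "g e0 \<noteq> 0"
      then obtain C' where C': "circuit M C'" "e0 \<in> C'" "C' \<subseteq> {e \<in> ?E. g e \<noteq> 0}"
        using thin_dependence_contains_circuit[OF rep \<open>thin_dependence ?E A f g\<close>]
          e0 cocircuit_subset_ground[OF b] by blast
      then have "C' \<inter> b = {e0}" using g0 e0 by auto
      then show False using circuit_cocircuit_not_singleton[OF C'(1) b] by blast
    qed
    ultimately show ?thesis
      using thin_sum_zero_iff_sum[OF fin(1) subset_refl, of "\<lambda>e. c C e * d e"] by simp
  qed
  moreover have "d e \<noteq> 0" if "e \<in> b" for e using h(3) that by (auto simp: d_def)
  ultimately show ?thesis using that by blast
qed

lemma thin_represents_imp_paintable:
  fixes f :: "'e \<Rightarrow> 'a \<Rightarrow> 'k::{field,finite}"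
  assumes tame: "tame M" and rep: "thin_represents A f M"
  shows "paintable TYPE('k) M"
proof -
  have "\<forall>C. \<exists>c. circuit M C \<longrightarrow> thin_dependence (ground M) A f c \<and> (\<forall>e. c e \<noteq> 0 \<longleftrightarrow> e \<in> C)"
    using circuit_thin_dependence[OF rep] by metis
  then obtain c where c: "\<And>C. circuit M C \<Longrightarrow> thin_dependence (ground M) A f (c C)"
      "\<And>C e. circuit M C \<Longrightarrow> c C e \<noteq> 0 \<longleftrightarrow> e \<in> C"
    by metis
  have "\<forall>b. \<exists>d. cocircuit M b \<longrightarrow> (\<forall>e\<in>b. d e \<noteq> 0) \<and>
      (\<forall>C. circuit M C \<longrightarrow> thin_sum_zero (C \<inter> b) (\<lambda>e. c C e * d e))"
    using cocircuit_vector[OF tame rep _ c] by metis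
  then obtain d where "\<forall>b. cocircuit M b \<longrightarrow> (\<forall>e\<in>b. d b e \<noteq> 0) \<and>
      (\<forall>C. circuit M C \<longrightarrow> thin_sum_zero (C \<inter> b) (\<lambda>e. c C e * d b e))"
    by metis
  then have "painting M c d" using c(2) unfolding painting_def by auto
  then show ?thesis unfolding paintable_def by blast
qed

text \<open>For \<open>e\<close> in an independent set \<open>I\<close> some cocircuit meets
  \<open>I\<close> only in \<open>e\<close>, and its coordinate isolates the coefficient of
  \<open>e\<close>. For dependent \<open>I\<close>, the colours of a circuit inside
  \<open>I\<close>, extended by zero, form a thin dependence.\<close>

lemma paintable_imp_thin_sums_matroid:
  assumes tame: "tame M" and "paintable TYPE('k::field) M"
  shows "thin_sums_matroid TYPE('k) M"
proof -
  obtain c d :: "'e set \<Rightarrow> 'e \<Rightarrow> 'k" where cd: "painting M c d"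
    using assms(2) unfolding paintable_def by blast
  let ?E = "ground M"
  let ?A = "{b. cocircuit M b}"
  define f where "f e b = (if e \<in> b then d b e else 0)" for e b
  have "I \<in> indeps M \<longleftrightarrow> thinly_independent ?E ?A f I" if IE: "I \<subseteq> ?E" for I
  proof
    assume I: "I \<in> indeps M"
    have "l e = 0" if l: "thin_dependence ?E ?A f l" "\<forall>e\<in>?E - I. l e = 0" "e \<in> ?E" for l e
    proof (cases "e \<in> I")
      case True
      have cover: "?E = insert e ((I - {e}) \<union> (?E - I))" using IE True by blast
      obtain b where b: "cocircuit M b" "e \<in> b" "b \<subseteq> insert e (?E - I)"
      proof (rule circuit_or_cocircuit[OF cover])
        fix C assume "circuit M C" "e \<in> C" "C \<subseteq> insert e (I - {e})"
        then show thesis using I2[OF I, of C] circuitD(2) True by blast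
      qed (use that in auto)
      have zero: "l x * f x b = 0" if "x \<in> ?E - {e}" for x
        using l(2) b(3) that by (auto simp: f_def)
      have "thin_sum_zero ?E (\<lambda>x. l x * f x b)" using l(1) b(1) by (simp add: thin_dependence_def)
      then have "l e * f e b = 0"
        using thin_sum_zero_iff_sum[of "{e}" ?E "\<lambda>x. l x * f x b"] zero l(3) by auto
      then show ?thesis using b(1,2) cd by (auto simp: f_def painting_def)
    qed (use l in auto)
    then show "thinly_independent ?E ?A f I" using IE unfolding thinly_independent_def by blast
  next
    assume I: "thinly_independent ?E ?A f I"
    show "I \<in> indeps M"
    proof (rule ccontr)
      assume "I \<notin> indeps M"
      then obtain C where C: "circuit M C" "C \<subseteq> I" using obtain_circuit[OF IE] by metis
      let ?l = "\<lambda>e. if e \<in> C then c C e else 0"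
      have "thin_sum_zero ?E (\<lambda>e. ?l e * f e b)" if b: "cocircuit M b" for b
      proof -
        have fin: "finite (C \<inter> b)" using tame C(1) b by (auto simp: tame_def)
        have "thin_sum_zero (C \<inter> b) (\<lambda>e. c C e * d b e)"
          using cd C(1) b by (auto simp: painting_def)
        then have "(\<Sum>e\<in>C \<inter> b. ?l e * f e b) = 0"
          using thin_sum_zero_iff_sum[OF fin subset_refl, of "\<lambda>e. c C e * d b e"]
          by (simp add: f_def)
        moreover have "C \<inter> b \<subseteq> ?E" using circuitD(1)[OF C(1)] by auto
        ultimately show ?thesis
          by (subst thin_sum_zero_iff_sum[OF fin]) (auto simp: f_def)
      qed
      then have "thin_dependence ?E ?A f ?l" by (simp add: thin_dependence_def)
      moreover have "\<forall>e\<in>?E - I. ?l e = 0" using C(2) by auto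
      ultimately have "\<forall>e\<in>?E. ?l e = 0" using I unfolding thinly_independent_def by blast
      moreover have "C \<noteq> {}" using circuitD(2)[OF C(1)] I1 by metis
      moreover from this obtain e where e: "e \<in> C" by auto
      moreover have "c C e \<noteq> 0" using cd C(1) e unfolding painting_def by blast
      ultimately show False using circuitD(1)[OF C(1)] by (auto dest!: bspec[of _ _ e])
    qed
  qed
  then have "thin_represents ?A f M"
    using indeps_ground unfolding thin_represents_def by (auto simp: thinly_independent_def)
  then show ?thesis by (rule thin_represents_imp_thin_sums_matroid)
qed

end

section \<open>Finite minors\<close>

text \<open>Passes from the image set used in \<open>represents\<close> to coefficients indexed by
  the elements themselves, the form in which dependences of a minor are compared with
  circuits.\<close>

lemma (in vector_space) inj_independent_iff:
  assumes "finite I"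
  shows "inj_on v I \<and> \<not> dependent (v ` I) \<longleftrightarrow>
    (\<forall>l. (\<Sum>e\<in>I. l e *s v e) = 0 \<longrightarrow> (\<forall>e\<in>I. l e = 0))"
proof (intro iffI allI impI)
  fix l assume *: "inj_on v I \<and> \<not> dependent (v ` I)" and l: "(\<Sum>e\<in>I. l e *s v e) = 0"
  have "(\<Sum>x\<in>v ` I. l (the_inv_into I v x) *s x) = (\<Sum>e\<in>I. l e *s v e)"
    using * by (subst sum.reindex) (auto simp: the_inv_into_f_f)
  then have "\<forall>x\<in>v ` I. l (the_inv_into I v x) = 0"
    using * l assms dependent_finite[of "v ` I"] by auto
  then show "\<forall>e\<in>I. l e = 0" using * by (auto simp: the_inv_into_f_f)
next
  assume R: "\<forall>l. (\<Sum>e\<in>I. l e *s v e) = 0 \<longrightarrow> (\<forall>e\<in>I. l e = 0)"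
  have inj: "inj_on v I"
  proof (rule inj_onI, rule ccontr)
    fix x y assume xy: "x \<in> I" "y \<in> I" "v x = v y" "x \<noteq> y"
    let ?l = "\<lambda>e. if e = x then 1 else if e = y then - 1 else 0"
    have "(\<Sum>e\<in>I. ?l e *s v e) = (\<Sum>e\<in>{x, y}. ?l e *s v e)"
      by (rule sum.mono_neutral_right) (use assms xy in auto)
    also have "\<dots> = 0" using xy by simp
    finally show False using R[rule_format, of ?l x] xy by simp
  qed
  moreover have "\<not> dependent (v ` I)"
  proof
    assume "dependent (v ` I)"
    then obtain u x where u: "x \<in> v ` I" "u x \<noteq> 0" "(\<Sum>x\<in>v ` I. u x *s x) = 0"
      using dependent_finite[of "v ` I"] assms by auto
    have "(\<Sum>e\<in>I. u (v e) *s v e) = 0" using u(3) inj by (simp add: sum.reindex)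
    then show False using R[rule_format, of "\<lambda>e. u (v e)"] u(1,2) by auto
  qed
  ultimately show "inj_on v I \<and> \<not> dependent (v ` I)" by blast
qed

lemma fun_lincomb_apply: "(\<Sum>e\<in>I. fun_scale (l e) (v e)) x = (\<Sum>e\<in>I. l e * v e x)"
  by (induction I rule: infinite_finite_induct) (auto simp: fun_scale_def)

lemma fun_lincomb_eq_0_iff:
  "(\<Sum>e\<in>I. fun_scale (l e) (v e)) = 0 \<longleftrightarrow> (\<forall>x. (\<Sum>e\<in>I. l e * v e x) = 0)"
  by (simp add: fun_eq_iff fun_lincomb_apply)

text \<open>Without a contribution at \<open>f\<close> the sum would reduce to its non-zero term at
  \<open>e\<close>. This carries non-vanishing from one element of a circuit or cocircuit to
  another.\<close>

lemma two_term_orthogonality: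
  fixes l m :: "'e \<Rightarrow> 'k::field"
  assumes "finite G" "(\<Sum>x\<in>G. l x * m x) = 0" "e \<in> G" "l e * m e \<noteq> 0"
    and "\<And>x. x \<in> G \<Longrightarrow> l x * m x \<noteq> 0 \<Longrightarrow> x = e \<or> x = f"
  shows "l f \<noteq> 0 \<and> m f \<noteq> 0"
proof (rule ccontr)
  assume *: "\<not> (l f \<noteq> 0 \<and> m f \<noteq> 0)"
  have zero: "l x * m x = 0" if "x \<in> G - {e}" for x
    using assms(5)[of x] * that by auto
  have "(\<Sum>x\<in>G. l x * m x) = (\<Sum>x\<in>{e}. l x * m x)"
    by (rule sum.mono_neutral_right) (use assms(1,3) zero in auto)
  then show False using assms(2,4) by simp
qed

lemma obtain_maximal_finite:
  assumes "finite X" "{} \<in> \<I>"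
  obtains I where "I \<in> \<I>" "I \<subseteq> X" "\<And>x. x \<in> X - I \<Longrightarrow> insert x I \<notin> \<I>"
proof -
  have "finite {I \<in> \<I>. I \<subseteq> X}" "{} \<in> {I \<in> \<I>. I \<subseteq> X}"
    using assms by auto
  then obtain I where I: "I \<in> {I \<in> \<I>. I \<subseteq> X}"
      "\<forall>J\<in>{I \<in> \<I>. I \<subseteq> X}. I \<subseteq> J \<longrightarrow> I = J"
    using finite_has_maximal2[of "{I \<in> \<I>. I \<subseteq> X}" "{}"] by metis
  have "insert x I \<notin> \<I>" if "x \<in> X - I" for x
    using I(2)[rule_format, of "insert x I"] I(1) that by auto
  then show ?thesis using that I(1) by auto
qed

lemma represents_indeps_iff:
  fixes scale :: "'k::field \<Rightarrow> 'v::ab_group_add \<Rightarrow> 'v"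
  assumes "represents scale w N" "finite (ground N)"
  shows "I \<in> indeps N \<longleftrightarrow>
    I \<subseteq> ground N \<and> (\<forall>l. (\<Sum>e\<in>I. scale (l e) (w e)) = 0 \<longrightarrow> (\<forall>e\<in>I. l e = 0))"
proof -
  interpret vector_space scale using assms(1) by (simp add: represents_def)
  show ?thesis
  proof (cases "I \<subseteq> ground N")
    case True
    then have "finite I" using assms(2) finite_subset by blast
    then show ?thesis using assms(1) inj_independent_iff[of I w] by (simp add: represents_def)
  qed (use assms(1) in \<open>simp add: represents_def\<close>)
qed

section \<open>Paintings and representations of finite minors\<close>

context matroid
begin

text \<open>A circuit inside \<open>I \<union> C\<close> meets a cocircuit avoiding \<open>C\<close>
  only within \<open>I\<close>, so its colours restrict to a linear dependence on \<open>I\<close>.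
  Conversely, if \<open>I\<close> is independent in the minor, each \<open>e\<close> in
  \<open>I\<close> lies in a cocircuit that avoids \<open>C\<close> and the rest of
  \<open>I\<close>, which forces its coefficient to vanish.\<close>

lemma painting_imp_minor_representable:
  fixes c d :: "'e set \<Rightarrow> 'e \<Rightarrow> 'k::field"
  assumes cd: "painting M c d" and N: "minor N M" and fin: "finite (ground N)"
  shows "representable TYPE('k) N"
proof -
  obtain C D where CD: "C \<subseteq> ground M" "N = delete (contract M C) D"
    using N by (auto simp: minor_def)
  let ?G = "ground M - C - D"
  have finG: "finite ?G" using fin by (simp add: CD(2) ground_minor)
  \<comment> \<open>The coordinates are sets of elements, with 0 at all that are not cocircuits
    avoiding \<open>C\<close>; \<open>represents_imp_representable\<close> later moves the vectors
    to the prescribed space.\<close>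
  define v where "v e b = (if cocircuit M b \<and> b \<inter> C = {} \<and> e \<in> b then d b e else 0)" for e b
  have "I \<in> indeps N \<longleftrightarrow> (\<forall>l. (\<Sum>e\<in>I. fun_scale (l e) (v e)) = 0 \<longrightarrow> (\<forall>e\<in>I. l e = 0))"
    if I: "I \<subseteq> ground M - C - D" for I
  proof
    assume "I \<in> indeps N"
    then have ind: "\<And>X. circuit M X \<Longrightarrow> X \<subseteq> I \<union> C \<Longrightarrow> X \<inter> I = {}"
      using indeps_minor_iff[OF CD(1)] CD(2) by blast
    show "\<forall>l. (\<Sum>e\<in>I. fun_scale (l e) (v e)) = 0 \<longrightarrow> (\<forall>e\<in>I. l e = 0)"
    proof (intro allI impI ballI)
      fix l e assume l: "(\<Sum>e\<in>I. fun_scale (l e) (v e)) = 0" and e: "e \<in> I"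
      have cover: "ground M = insert e ((I - {e} \<union> C) \<union> (ground M - I - C))"
        using I CD(1) e by blast
      obtain b where b: "cocircuit M b" "e \<in> b" "b \<subseteq> insert e (ground M - I - C)"
      proof (rule circuit_or_cocircuit[OF cover])
        fix X assume X: "circuit M X" "e \<in> X" "X \<subseteq> insert e (I - {e} \<union> C)"
        have "X \<subseteq> I \<union> C" using X(3) e by auto
        then show thesis using ind[OF X(1)] X(2) e by blast
      qed (use that I e in auto)
      have bC: "b \<inter> C = {}" using b(3) I e by auto
      have "(\<Sum>x\<in>I. l x * v x b) = (\<Sum>x\<in>{e}. l x * v x b)"
        by (rule sum.mono_neutral_right)
          (use finite_subset[OF I finG] e b(3) in \<open>auto simp: v_def\<close>)
      also have "(\<Sum>x\<in>I. l x * v x b) = 0" using l by (simp add: fun_lincomb_eq_0_iff)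
      finally have "l e * d b e = 0" using b bC by (simp add: v_def)
      then show "l e = 0" using cd b(1,2) unfolding painting_def by auto
    qed
  next
    assume R: "\<forall>l. (\<Sum>e\<in>I. fun_scale (l e) (v e)) = 0 \<longrightarrow> (\<forall>e\<in>I. l e = 0)"
    have "X \<inter> I = {}" if X: "circuit M X" "X \<subseteq> I \<union> C" for X
    proof -
      let ?l = "\<lambda>e. if e \<in> X then c X e else 0"
      have "(\<Sum>e\<in>I. ?l e * v e b) = 0" for b
      proof (cases "cocircuit M b \<and> b \<inter> C = {}")
        case True
        then have sub: "X \<inter> b \<subseteq> I" using X(2) by blast
        then have fin: "finite (X \<inter> b)" using finite_subset[OF _ finite_subset[OF I finG]] by blast
        have "(\<Sum>e\<in>I. ?l e * v e b) = (\<Sum>e\<in>X \<inter> b. ?l e * v e b)"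
          by (rule sum.mono_neutral_right)
            (use finite_subset[OF I finG] sub in \<open>auto simp: v_def\<close>)
        also have "\<dots> = (\<Sum>e\<in>X \<inter> b. c X e * d b e)" using True by (simp add: v_def)
        also have "\<dots> = 0"
          by (rule iffD1[OF thin_sum_zero_iff_sum[OF fin subset_refl]])
            (use cd X(1) True in \<open>auto simp: painting_def\<close>)
        finally show ?thesis .
      next
        case False
        then have "v e b = 0" for e by (auto simp: v_def)
        then show ?thesis by simp
      qed
      then have zero: "\<forall>e\<in>I. ?l e = 0" using R[rule_format, of ?l] by (simp add: fun_lincomb_eq_0_iff)
      have "c X e \<noteq> 0" if "e \<in> X" for e using cd X(1) that unfolding painting_def by blast
      then show ?thesis using zero by (metis disjoint_iff)
    qed
    then show "I \<in> indeps N" using indeps_minor_iff[OF CD(1)] CD(2) I by blast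
  qed
  then have eq: "I \<in> indeps N \<longleftrightarrow> inj_on v I \<and> \<not> module.dependent fun_scale (v ` I)"
    if "I \<subseteq> ?G" for I
    using vector_space.inj_independent_iff[OF vector_space_fun_scale finite_subset[OF that finG], of v]
      that by simp
  have "indeps N \<subseteq> Pow ?G" using indeps_minor_iff[OF CD(1)] CD(2) by blast
  then have "represents (fun_scale :: 'k \<Rightarrow> ('e set \<Rightarrow> 'k) \<Rightarrow> 'e set \<Rightarrow> 'k) v N"
    using eq vector_space_fun_scale unfolding represents_def by (auto simp: CD(2) ground_minor)
  then show ?thesis by (rule represents_imp_representable)
qed

text \<open>Let \<open>I\<close> be maximal independent in the minor within
  \<open>X \<inter> G - {e}\<close>. If \<open>insert e I\<close> were independent, some cocircuit
  \<open>b\<close> through \<open>e\<close> would avoid \<open>I \<union> C\<close> and meet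
  \<open>X\<close> in a further element \<open>f\<close>; a circuit \<open>Y\<close> showing that
  \<open>insert f I\<close> is dependent would then meet \<open>b\<close> in \<open>f\<close> alone.
  So \<open>insert e I\<close> carries a dependence, non-zero at \<open>e\<close> because
  \<open>I\<close> is independent.\<close>

lemma minor_dependence_of_circuit:
  fixes w :: "'e \<Rightarrow> 'e \<Rightarrow> 'k::field" and C D :: "'e set"
  defines "G \<equiv> ground M - C - D"
  assumes C: "C \<subseteq> ground M" and fin: "finite G"
    and rep: "represents fun_scale w (delete (contract M C) D)"
    and X: "circuit M X" "X \<subseteq> G \<union> C" "e \<in> X \<inter> G"
  obtains l where "(\<Sum>x\<in>G. fun_scale (l x) (w x)) = 0" "l e \<noteq> 0" "\<And>x. l x \<noteq> 0 \<Longrightarrow> x \<in> X \<inter> G"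
proof -
  let ?N = "delete (contract M C) D"
  have ind: "I \<in> indeps ?N \<longleftrightarrow> I \<subseteq> G \<and>
      (\<forall>X. circuit M X \<longrightarrow> X \<subseteq> I \<union> C \<longrightarrow> X \<inter> I = {})" for I
    unfolding G_def by (rule indeps_minor_iff[OF C])
  have gN: "ground ?N = G" by (simp add: G_def ground_minor)
  have lin: "I \<in> indeps ?N \<longleftrightarrow>
      I \<subseteq> G \<and> (\<forall>l. (\<Sum>e\<in>I. fun_scale (l e) (w e)) = 0 \<longrightarrow> (\<forall>e\<in>I. l e = 0))" for I
    using represents_indeps_iff[OF rep, of I] fin unfolding gN by simp
  have "finite (X \<inter> G - {e})" "{} \<in> indeps ?N" using fin ind by auto
  then obtain I where I: "I \<in> indeps ?N" "I \<subseteq> X \<inter> G - {e}"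
      "\<And>x. x \<in> X \<inter> G - {e} - I \<Longrightarrow> insert x I \<notin> indeps ?N"
    by (rule obtain_maximal_finite) blast
  have eC: "e \<notin> C" and GE: "G \<subseteq> ground M" and GC: "G \<inter> C = {}" using X(3) by (auto simp: G_def)
  have fund: "x \<in> Y" if Y: "circuit M Y" "Y \<subseteq> insert x I \<union> C" "Y \<inter> insert x I \<noteq> {}" for x Y
  proof (rule ccontr)
    assume "x \<notin> Y"
    then have "Y \<subseteq> I \<union> C" "Y \<inter> I \<noteq> {}" using Y(2,3) by auto
    then show False using I(1)[unfolded ind] Y(1) by metis
  qed
  have dep: "insert e I \<notin> indeps ?N"
  proof
    assume eI: "insert e I \<in> indeps ?N"
    have cover: "ground M = insert e ((I \<union> C) \<union> (ground M - I - C - {e}))"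
      using X(3) I(2) GE C by blast
    obtain b where b: "cocircuit M b" "e \<in> b" "b \<subseteq> insert e (ground M - I - C - {e})"
    proof (rule circuit_or_cocircuit[OF cover])
      fix Y assume Y: "circuit M Y" "e \<in> Y" "Y \<subseteq> insert e (I \<union> C)"
      then show thesis using eI[unfolded ind] by auto
    qed (use that I(2) eC in auto)
    have disj: "b \<inter> (I \<union> C) = {}" using b(3) I(2) eC by auto
    obtain f where f: "f \<in> X \<inter> b" "f \<noteq> e"
      using circuit_cocircuit_not_singleton[OF X(1) b(1), of e] X(3) b(2) by blast
    have "f \<in> X \<inter> G - {e} - I" using f disj X(2) by blast
    then have "insert f I \<notin> indeps ?N" "insert f I \<subseteq> G" using I(2,3) by auto
    then obtain Y where Y: "circuit M Y" "Y \<subseteq> insert f I \<union> C" "Y \<inter> insert f I \<noteq> {}"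
      unfolding ind by blast
    have "Y \<inter> b = {f}" using fund[OF Y] Y(2) disj f(1) by auto
    then show False using circuit_cocircuit_not_singleton[OF Y(1) b(1)] by blast
  qed
  have IG: "I \<subseteq> G" "e \<notin> I" using I(2) by auto
  then obtain l where l: "(\<Sum>x\<in>insert e I. fun_scale (l x) (w x)) = 0" "\<exists>x\<in>insert e I. l x \<noteq> 0"
    using dep X(3) unfolding lin by blast
  have finI: "finite I" using IG(1) fin finite_subset by blast
  have "l e \<noteq> 0"
  proof
    assume "l e = 0"
    then have "(\<Sum>x\<in>I. fun_scale (l x) (w x)) = 0"
      using l(1) finI IG(2) by (simp add: fun_scale_def zero_fun_def)
    then show False using I(1)[unfolded lin] l(2) \<open>l e = 0\<close> by blast
  qed
  let ?l = "\<lambda>x. if x \<in> insert e I then l x else 0"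
  have "(\<Sum>x\<in>G. fun_scale (?l x) (w x)) = (\<Sum>x\<in>insert e I. fun_scale (?l x) (w x))"
    by (rule sum.mono_neutral_right) (use fin IG X(3) in \<open>auto simp: fun_scale_def zero_fun_def\<close>)
  also have "\<dots> = (\<Sum>x\<in>insert e I. fun_scale (l x) (w x))" by (rule sum.cong) auto
  also note l(1)
  finally have "(\<Sum>x\<in>G. fun_scale (?l x) (w x)) = 0" .
  moreover have "?l e \<noteq> 0" using \<open>l e \<noteq> 0\<close> by simp
  moreover have "x \<in> X \<inter> G" if "?l x \<noteq> 0" for x using that I(2) X(3) by (auto split: if_splits)
  ultimately show ?thesis by (rule that)
qed

text \<open>Let \<open>I\<close> be maximal independent in the minor within \<open>G - b\<close>.
  Then \<open>insert e I\<close> is independent, since a circuit to the contrary would meet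
  \<open>b\<close> in \<open>e\<close> alone. A linear functional that is 1 at \<open>w e\<close>
  and 0 on \<open>I\<close> vanishes on all of \<open>G - b\<close>, and its values on the vectors
  form \<open>m\<close>.\<close>

lemma minor_covector_of_cocircuit:
  fixes w :: "'e \<Rightarrow> 'e \<Rightarrow> 'k::field" and C D :: "'e set"
  defines "G \<equiv> ground M - C - D"
  assumes C: "C \<subseteq> ground M" and fin: "finite G"
    and rep: "represents fun_scale w (delete (contract M C) D)"
    and b: "cocircuit M b" "b \<inter> C = {}" "e \<in> b \<inter> G"
  obtains m where "\<And>l. (\<Sum>x\<in>G. fun_scale (l x) (w x)) = 0 \<Longrightarrow> (\<Sum>x\<in>G. l x * m x) = 0"
    "m e \<noteq> 0" "\<And>x. m x \<noteq> 0 \<Longrightarrow> x \<in> b \<inter> G"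
proof -
  let ?N = "delete (contract M C) D"
  interpret W: vector_space "fun_scale :: 'k \<Rightarrow> ('e \<Rightarrow> 'k) \<Rightarrow> 'e \<Rightarrow> 'k"
    by (rule vector_space_fun_scale)
  interpret K: vector_space "(*) :: 'k \<Rightarrow> 'k \<Rightarrow> 'k"
    by unfold_locales (auto simp: algebra_simps)
  interpret P: vector_space_pair "fun_scale :: 'k \<Rightarrow> ('e \<Rightarrow> 'k) \<Rightarrow> 'e \<Rightarrow> 'k" "(*) :: 'k \<Rightarrow> 'k \<Rightarrow> 'k" ..
  have ind: "I \<in> indeps ?N \<longleftrightarrow> I \<subseteq> G \<and>
      (\<forall>X. circuit M X \<longrightarrow> X \<subseteq> I \<union> C \<longrightarrow> X \<inter> I = {})" for I
    unfolding G_def by (rule indeps_minor_iff[OF C])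
  have gN: "ground ?N = G" by (simp add: G_def ground_minor)
  have lin: "I \<in> indeps ?N \<longleftrightarrow>
      I \<subseteq> G \<and> (\<forall>l. (\<Sum>e\<in>I. fun_scale (l e) (w e)) = 0 \<longrightarrow> (\<forall>e\<in>I. l e = 0))" for I
    using represents_indeps_iff[OF rep, of I] fin unfolding gN by simp
  have "finite (G - b)" "{} \<in> indeps ?N" using fin ind by auto
  then obtain I where I: "I \<in> indeps ?N" "I \<subseteq> G - b"
      "\<And>x. x \<in> G - b - I \<Longrightarrow> insert x I \<notin> indeps ?N"
    by (rule obtain_maximal_finite) blast
  have fund: "x \<in> Y" if Y: "circuit M Y" "Y \<subseteq> insert x I \<union> C" "Y \<inter> insert x I \<noteq> {}" for x Y
  proof (rule ccontr)
    assume "x \<notin> Y"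
    then have "Y \<subseteq> I \<union> C" "Y \<inter> I \<noteq> {}" using Y(2,3) by auto
    then show False using I(1)[unfolded ind] Y(1) by metis
  qed
  have eI: "insert e I \<in> indeps ?N"
  proof (rule ccontr)
    assume "insert e I \<notin> indeps ?N"
    moreover have "insert e I \<subseteq> G" using I(2) b(3) by auto
    ultimately obtain Y where Y: "circuit M Y" "Y \<subseteq> insert e I \<union> C" "Y \<inter> insert e I \<noteq> {}"
      unfolding ind by blast
    have "Y \<inter> b = {e}" using fund[OF Y] Y(2) I(2) b(2,3) by auto
    then show False using circuit_cocircuit_not_singleton[OF Y(1) b(1)] by blast
  qed
  then have inj: "inj_on w (insert e I)" and "\<not> W.dependent (w ` insert e I)"
    using rep by (auto simp: represents_def)
  then obtain \<phi> where \<phi>: "Vector_Spaces.linear fun_scale (*) \<phi>"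
      "\<forall>y\<in>w ` insert e I. \<phi> y = (if y = w e then 1 else 0)"
    using P.linear_independent_extend[of "w ` insert e I" "\<lambda>y. if y = w e then 1 else 0"] by blast
  interpret \<phi>: Vector_Spaces.linear fun_scale "(*)" \<phi> by (rule \<phi>(1))
  have \<phi>_sum: "\<phi> (\<Sum>x\<in>S. fun_scale (l x) (w x)) = (\<Sum>x\<in>S. l x * \<phi> (w x))" for S l
    by (simp add: \<phi>.sum \<phi>.scale)
  have eG: "e \<notin> I" using I(2) b(3) by auto
  have \<phi>e: "\<phi> (w e) = 1" using \<phi>(2) by simp
  have \<phi>I: "\<phi> (w x) = 0" if "x \<in> I" for x
  proof -
    have "w x \<noteq> w e" using inj_onD[OF inj, of x e] that eG by auto
    then show ?thesis using \<phi>(2) that by simp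
  qed
  have \<phi>b: "\<phi> (w x) = 0" if x: "x \<in> G - b" for x
  proof (cases "x \<in> I")
    case False
    then have "insert x I \<notin> indeps ?N" "insert x I \<subseteq> G" using I(2,3) x by auto
    then obtain l where l: "(\<Sum>y\<in>insert x I. fun_scale (l y) (w y)) = 0" "\<exists>y\<in>insert x I. l y \<noteq> 0"
      unfolding lin by blast
    have finI: "finite I" using I(2) fin finite_subset by blast
    have "l x \<noteq> 0"
    proof
      assume "l x = 0"
      then have "(\<Sum>y\<in>I. fun_scale (l y) (w y)) = 0"
        using l(1) finI False by (simp add: fun_scale_def zero_fun_def)
      then show False using I(1)[unfolded lin] l(2) \<open>l x = 0\<close> by blast
    qed
    moreover have "(\<Sum>y\<in>insert x I. l y * \<phi> (w y)) = 0"
      using \<phi>_sum[of l "insert x I"] l(1) \<phi>.zero by simp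
    ultimately show ?thesis using finI False \<phi>I by simp
  qed (rule \<phi>I)
  let ?m = "\<lambda>x. if x \<in> G then \<phi> (w x) else 0"
  have "(\<Sum>x\<in>G. l x * ?m x) = 0" if "(\<Sum>x\<in>G. fun_scale (l x) (w x)) = 0" for l
    using \<phi>_sum[of l G] that \<phi>.zero by simp
  moreover have "?m e \<noteq> 0" using b(3) \<phi>e by simp
  moreover have "x \<in> b \<inter> G" if "?m x \<noteq> 0" for x using that \<phi>b[of x] by (auto split: if_splits)
  ultimately show ?thesis by (rule that)
qed

text \<open>The chosen circuits and cocircuits need not restrict to circuits and cocircuits of the
  finite minor. Adding, for any two elements \<open>e\<close>, \<open>f\<close> of a relevant intersection, a cocircuit
  meeting the circuit exactly in \<open>{e, f}\<close> (and dually) forces a dependence which is non-zero at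
  one relevant element to be non-zero at all of them.\<close>

lemma finite_partial_painting:
  assumes tame: "tame M"
    and min: "\<And>N. minor N M \<Longrightarrow> finite (ground N) \<Longrightarrow> representable TYPE('k::field) N"
    and \<O>: "finite \<O>" "\<And>X. X \<in> \<O> \<Longrightarrow> circuit M X"
    and \<B>: "finite \<B>" "\<And>b. b \<in> \<B> \<Longrightarrow> cocircuit M b"
  shows "\<exists>c d :: 'e set \<Rightarrow> 'e \<Rightarrow> 'k::field. \<forall>X\<in>\<O>. \<forall>b\<in>\<B>.
    (\<forall>e\<in>X \<inter> b. c X e \<noteq> 0 \<and> d b e \<noteq> 0) \<and> (\<Sum>e\<in>X \<inter> b. c X e * d b e) = 0"
proof -
  define F where "F = (\<Union>X\<in>\<O>. \<Union>b\<in>\<B>. X \<inter> b)"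
  have finF: "finite F" using \<O> \<B> tame unfolding F_def tame_def by blast
  have "\<exists>b. circuit M X \<and> e \<in> X \<and> f \<in> X \<and> e \<noteq> f \<longrightarrow> cocircuit M b \<and> X \<inter> b = {e, f}" for X e f
    by (cases "circuit M X \<and> e \<in> X \<and> f \<in> X \<and> e \<noteq> f") (auto elim: cocircuit_through_pair)
  then obtain cc where cc: "\<And>X e f. circuit M X \<Longrightarrow> e \<in> X \<Longrightarrow> f \<in> X \<Longrightarrow> e \<noteq> f \<Longrightarrow>
      cocircuit M (cc X e f) \<and> X \<inter> cc X e f = {e, f}"
    by metis
  have "\<exists>X. cocircuit M b \<and> e \<in> b \<and> f \<in> b \<and> e \<noteq> f \<longrightarrow> circuit M X \<and> X \<inter> b = {e, f}" for b e f
    by (cases "cocircuit M b \<and> e \<in> b \<and> f \<in> b \<and> e \<noteq> f") (auto elim: circuit_through_pair)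
  then obtain oo where oo: "\<And>b e f. cocircuit M b \<Longrightarrow> e \<in> b \<Longrightarrow> f \<in> b \<Longrightarrow> e \<noteq> f \<Longrightarrow>
      circuit M (oo b e f) \<and> oo b e f \<inter> b = {e, f}"
    by metis
  \<comment> \<open>Non-zero colours are required only on \<open>F\<close>, so finitely many
    auxiliary circuits and cocircuits suffice, although \<open>G\<close> below may be larger than
    \<open>F\<close>.\<close>
  define pairs where "pairs \<S> = {(S, e, f). S \<in> \<S> \<and> e \<in> S \<inter> F \<and> f \<in> S \<inter> F \<and> e \<noteq> f}" for \<S>
  have fin_pairs: "finite (pairs \<S>)" if "finite \<S>" for \<S>
    by (rule finite_subset[of _ "\<S> \<times> F \<times> F"]) (use that finF in \<open>auto simp: pairs_def\<close>)
  define \<O>' where "\<O>' = \<O> \<union> (\<lambda>(b, e, f). oo b e f) ` pairs \<B>"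
  define \<B>' where "\<B>' = \<B> \<union> (\<lambda>(X, e, f). cc X e f) ` pairs \<O>"
  have \<O>': "finite \<O>'" "\<And>X. X \<in> \<O>' \<Longrightarrow> circuit M X"
    using \<O> \<B> oo fin_pairs by (auto simp: \<O>'_def pairs_def)
  have \<B>': "finite \<B>'" "\<And>b. b \<in> \<B>' \<Longrightarrow> cocircuit M b"
    using \<O> \<B> cc fin_pairs by (auto simp: \<B>'_def pairs_def)
  \<comment> \<open>All intersections are kept, and they form a finite set by tameness. What remains
    of the circuits is contracted: every circuit in \<open>\<O>'\<close> then lies in
    \<open>G \<union> C\<close>, and no cocircuit in \<open>\<B>'\<close> meets
    \<open>C\<close>.\<close>
  define G where "G = (\<Union>X\<in>\<O>'. \<Union>b\<in>\<B>'. X \<inter> b)"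
  define C where "C = \<Union>\<O>' - G"
  define D where "D = ground M - G - C"
  have finG: "finite G" using \<O>' \<B>' tame unfolding G_def tame_def by blast
  have FG: "F \<subseteq> G" by (auto simp: F_def G_def \<O>'_def \<B>'_def)
  have sub: "C \<subseteq> ground M" "G \<subseteq> ground M"
    using circuitD(1)[OF \<O>'(2)] unfolding C_def G_def by fast+
  have G: "G = ground M - C - D" using sub by (auto simp: D_def C_def)
  have \<O>'_sub: "X \<subseteq> G \<union> C" if "X \<in> \<O>'" for X using that by (auto simp: C_def)
  have \<B>'_disj: "b \<inter> C = {}" if "b \<in> \<B>'" for b using that by (auto simp: C_def G_def)
  let ?N = "delete (contract M C) D"
  have "minor ?N M" unfolding minor_def using sub(1)
    by (intro exI[of _ C] exI[of _ D]) (auto simp: D_def)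
  moreover have "finite (ground ?N)" using finG by (simp add: ground_minor G)
  ultimately obtain w :: "'e \<Rightarrow> 'e \<Rightarrow> 'k" where rep: "represents fun_scale w ?N"
    using min unfolding representable_def by blast
  define dep where "dep l \<longleftrightarrow> (\<Sum>x\<in>G. fun_scale (l x) (w x)) = 0" for l
  have vec: "\<exists>l. dep l \<and> l e \<noteq> 0 \<and> (\<forall>x. l x \<noteq> 0 \<longrightarrow> x \<in> X \<inter> G)"
    if "X \<in> \<O>'" "e \<in> X \<inter> G" for X e
    using minor_dependence_of_circuit[OF sub(1) _ rep \<O>'(2)[OF that(1)], folded G]
      finG \<O>'_sub[OF that(1)] that(2) unfolding dep_def by metis
  have covec: "\<exists>m. (\<forall>l. dep l \<longrightarrow> (\<Sum>x\<in>G. l x * m x) = 0) \<and> m e \<noteq> 0 \<and> (\<forall>x. m x \<noteq> 0 \<longrightarrow> x \<in> b \<inter> G)"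
    if "b \<in> \<B>'" "e \<in> b \<inter> G" for b e
    using minor_covector_of_cocircuit[OF sub(1) _ rep \<B>'(2)[OF that(1)] \<B>'_disj[OF that(1)], folded G]
      finG that(2) unfolding dep_def by metis
  have "\<exists>l. dep l \<and> (\<forall>e\<in>X \<inter> F. l e \<noteq> 0) \<and> (\<forall>x. l x \<noteq> 0 \<longrightarrow> x \<in> X \<inter> G)" if X: "X \<in> \<O>" for X
  proof (cases "X \<inter> F = {}")
    case True
    then show ?thesis
      by (intro exI[of _ "\<lambda>_. 0"]) (auto simp: dep_def fun_scale_def zero_fun_def)
  next
    case False
    then obtain e where e: "e \<in> X \<inter> F" by blast
    have "X \<in> \<O>'" "e \<in> X \<inter> G" using X e FG by (auto simp: \<O>'_def)
    then obtain l where l: "dep l" "l e \<noteq> 0" "\<And>x. l x \<noteq> 0 \<Longrightarrow> x \<in> X \<inter> G"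
      using vec by metis
    have "l f \<noteq> 0" if f: "f \<in> X \<inter> F" "f \<noteq> e" for f
    proof -
      have Xef: "X \<inter> cc X e f = {e, f}" using cc[of X e f] \<O>(2)[OF X] e f by auto
      have "(X, e, f) \<in> pairs \<O>" using X e f by (auto simp: pairs_def)
      then have "cc X e f \<in> \<B>'" unfolding \<B>'_def by force
      moreover have "e \<in> cc X e f \<inter> G" using Xef e FG by auto
      ultimately obtain m where m: "\<And>l. dep l \<Longrightarrow> (\<Sum>x\<in>G. l x * m x) = 0" "m e \<noteq> 0"
          "\<And>x. m x \<noteq> 0 \<Longrightarrow> x \<in> cc X e f \<inter> G"
        using covec by metis
      have "l f \<noteq> 0 \<and> m f \<noteq> 0"
      proof (rule two_term_orthogonality[OF finG m(1)[OF l(1)]])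
        show "e \<in> G" using e FG by blast
        show "x = e \<or> x = f" if "l x * m x \<noteq> 0" for x
          using l(3)[of x] m(3)[of x] that Xef by auto
      qed (use l(2) m(2) in auto)
      then show ?thesis by blast
    qed
    then show ?thesis using l by metis
  qed
  then obtain c where c: "\<And>X. X \<in> \<O> \<Longrightarrow> dep (c X)"
      "\<And>X e. X \<in> \<O> \<Longrightarrow> e \<in> X \<inter> F \<Longrightarrow> c X e \<noteq> 0" "\<And>X x. X \<in> \<O> \<Longrightarrow> c X x \<noteq> 0 \<Longrightarrow> x \<in> X \<inter> G"
    by metis
  have "\<exists>m. (\<forall>l. dep l \<longrightarrow> (\<Sum>x\<in>G. l x * m x) = 0) \<and> (\<forall>e\<in>b \<inter> F. m e \<noteq> 0) \<and>
      (\<forall>x. m x \<noteq> 0 \<longrightarrow> x \<in> b \<inter> G)" if b: "b \<in> \<B>" for b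
  proof (cases "b \<inter> F = {}")
    case True
    then show ?thesis by (intro exI[of _ "\<lambda>_. 0"]) auto
  next
    case False
    then obtain e where e: "e \<in> b \<inter> F" by blast
    have "b \<in> \<B>'" "e \<in> b \<inter> G" using b e FG by (auto simp: \<B>'_def)
    then obtain m where m: "\<And>l. dep l \<Longrightarrow> (\<Sum>x\<in>G. l x * m x) = 0" "m e \<noteq> 0"
        "\<And>x. m x \<noteq> 0 \<Longrightarrow> x \<in> b \<inter> G"
      using covec by metis
    have "m f \<noteq> 0" if f: "f \<in> b \<inter> F" "f \<noteq> e" for f
    proof -
      have bef: "oo b e f \<inter> b = {e, f}" using oo[of b e f] \<B>(2)[OF b] e f by auto
      have "(b, e, f) \<in> pairs \<B>" using b e f by (auto simp: pairs_def)
      then have "oo b e f \<in> \<O>'" unfolding \<O>'_def by force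
      moreover have "e \<in> oo b e f \<inter> G" using bef e FG by auto
      ultimately obtain l where l: "dep l" "l e \<noteq> 0" "\<And>x. l x \<noteq> 0 \<Longrightarrow> x \<in> oo b e f \<inter> G"
        using vec by metis
      have "l f \<noteq> 0 \<and> m f \<noteq> 0"
      proof (rule two_term_orthogonality[OF finG m(1)[OF l(1)]])
        show "e \<in> G" using e FG by blast
        show "x = e \<or> x = f" if "l x * m x \<noteq> 0" for x
          using l(3)[of x] m(3)[of x] that bef by auto
      qed (use l(2) m(2) in auto)
      then show ?thesis by blast
    qed
    then show ?thesis using m by metis
  qed
  then obtain d where d: "\<And>b l. b \<in> \<B> \<Longrightarrow> dep l \<Longrightarrow> (\<Sum>x\<in>G. l x * d b x) = 0"
      "\<And>b e. b \<in> \<B> \<Longrightarrow> e \<in> b \<inter> F \<Longrightarrow> d b e \<noteq> 0" "\<And>b x. b \<in> \<B> \<Longrightarrow> d b x \<noteq> 0 \<Longrightarrow> x \<in> b \<inter> G"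
    by metis
  have "(\<forall>e\<in>X \<inter> b. c X e \<noteq> 0 \<and> d b e \<noteq> 0) \<and> (\<Sum>e\<in>X \<inter> b. c X e * d b e) = 0"
    if Xb: "X \<in> \<O>" "b \<in> \<B>" for X b
  proof
    have XbF: "X \<inter> b \<subseteq> F" using Xb by (auto simp: F_def)
    then show "\<forall>e\<in>X \<inter> b. c X e \<noteq> 0 \<and> d b e \<noteq> 0"
      using c(2)[OF Xb(1)] d(2)[OF Xb(2)] by blast
    have "(\<Sum>e\<in>X \<inter> b. c X e * d b e) = (\<Sum>e\<in>G. c X e * d b e)"
      by (rule sum.mono_neutral_left)
        (use finG XbF FG c(3)[OF Xb(1)] d(3)[OF Xb(2)] in auto)
    then show "(\<Sum>e\<in>X \<inter> b. c X e * d b e) = 0" using d(1)[OF Xb(2) c(1)[OF Xb(1)]] by simp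
  qed
  then show ?thesis by blast
qed

lemma minors_representable_imp_paintable:
  assumes tame: "tame M"
    and min: "\<And>N. minor N M \<Longrightarrow> finite (ground N) \<Longrightarrow> representable TYPE('k::{field,finite}) N"
  shows "paintable TYPE('k) M"
proof -
  \<comment> \<open>\<open>True\<close> marks colours of circuits, \<open>False\<close> those of
    cocircuits. Non-vanishing is imposed only on \<open>X \<inter> b\<close>, so by tameness each
    constraint involves finitely many variables.\<close>
  define P where "P = (\<lambda>(X, b) (h :: bool \<times> 'e set \<times> 'e \<Rightarrow> 'k).
    (\<forall>e\<in>X \<inter> b. h (True, X, e) \<noteq> 0 \<and> h (False, b, e) \<noteq> 0) \<and>
    (\<Sum>e\<in>X \<inter> b. h (True, X, e) * h (False, b, e)) = 0)"
  define Q where "Q = {X. circuit M X} \<times> {b. cocircuit M b}"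
  have "\<exists>h. \<forall>p\<in>P ` Q. p h"
  proof (rule finitary_constraints_compactness)
    fix p assume "p \<in> P ` Q"
    then obtain X b where Xb: "circuit M X" "cocircuit M b" "p = P (X, b)" by (auto simp: Q_def)
    let ?V = "{True, False} \<times> {X, b} \<times> (X \<inter> b)"
    have "finite ?V" using tame Xb by (auto simp: tame_def)
    moreover have "p g" if "\<forall>v\<in>?V. f v = g v" "p f" for f g
    proof -
      have eq: "f (True, X, e) = g (True, X, e)" "f (False, b, e) = g (False, b, e)"
        if "e \<in> X \<inter> b" for e
        using that \<open>\<forall>v\<in>?V. f v = g v\<close> by auto
      have "(\<Sum>e\<in>X \<inter> b. f (True, X, e) * f (False, b, e)) =
          (\<Sum>e\<in>X \<inter> b. g (True, X, e) * g (False, b, e))"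
        by (rule sum.cong) (simp_all add: eq)
      then show ?thesis using \<open>p f\<close> unfolding Xb(3) P_def by (auto simp: eq)
    qed
    ultimately show "\<exists>V. finite V \<and> (\<forall>f g. (\<forall>v\<in>V. f v = g v) \<longrightarrow> p f \<longrightarrow> p g)"
      by (intro exI[of _ ?V]) blast
  next
    fix \<F> assume "finite \<F>" "\<F> \<subseteq> P ` Q"
    then obtain R where R: "finite R" "R \<subseteq> Q" "\<F> = P ` R" by (meson finite_subset_image)
    have R': "finite (fst ` R)" "finite (snd ` R)" "\<And>X. X \<in> fst ` R \<Longrightarrow> circuit M X"
        "\<And>b. b \<in> snd ` R \<Longrightarrow> cocircuit M b"
      using R by (auto simp: Q_def)
    obtain c d :: "'e set \<Rightarrow> 'e \<Rightarrow> 'k" where cd: "\<forall>X\<in>fst ` R. \<forall>b\<in>snd ` R.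
        (\<forall>e\<in>X \<inter> b. c X e \<noteq> 0 \<and> d b e \<noteq> 0) \<and> (\<Sum>e\<in>X \<inter> b. c X e * d b e) = 0"
      using finite_partial_painting[OF tame min R'(1,3,2,4)] by blast
    let ?h = "\<lambda>(t, S, e). if t then c S e else d S e"
    have "P q ?h" if "q \<in> R" for q
      using cd[rule_format, of "fst q" "snd q"] that by (auto simp: P_def split: prod.split)
    then show "\<exists>h. \<forall>p\<in>\<F>. p h" unfolding R(3) by blast
  qed
  then obtain h where h: "\<And>X b. circuit M X \<Longrightarrow> cocircuit M b \<Longrightarrow> P (X, b) h"
    by (auto simp: Q_def)
  \<comment> \<open>An element of \<open>X\<close> that lies in no cocircuit, such as a loop, is
    unconstrained and may have colour 0 under \<open>h\<close>. The default 1 repairs this and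
    changes nothing on any \<open>X \<inter> b\<close>.\<close>
  define c where "c X e = (if h (True, X, e) = 0 then 1 else h (True, X, e))" for X e
  define d where "d b e = (if h (False, b, e) = 0 then 1 else h (False, b, e))" for b e
  have "thin_sum_zero (X \<inter> b) (\<lambda>e. c X e * d b e)" if Xb: "circuit M X" "cocircuit M b" for X b
  proof -
    have "(\<Sum>e\<in>X \<inter> b. c X e * d b e) = (\<Sum>e\<in>X \<inter> b. h (True, X, e) * h (False, b, e))"
      by (rule sum.cong) (use h[OF Xb] in \<open>auto simp: c_def d_def P_def\<close>)
    also have "\<dots> = 0" using h[OF Xb] by (simp add: P_def)
    finally show ?thesis
      using tame Xb by (subst thin_sum_zero_iff_sum[OF _ subset_refl]) (auto simp: tame_def)
  qed
  then have "painting M c d" unfolding painting_def by (auto simp: c_def d_def)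
  then show ?thesis unfolding paintable_def by blast
qed

end

theorem theorem4p5:
  fixes M :: "'e indep_system"
  assumes "matroid M" and "tame M"
  shows "(thin_sums_matroid TYPE('k::{field,finite}) M \<longleftrightarrow> paintable TYPE('k) M) \<and>
         (paintable TYPE('k) M \<longleftrightarrow>
            (\<forall>N. minor N M \<and> finite (ground N) \<longrightarrow> representable TYPE('k) N))"
proof -
  interpret matroid M by (rule assms(1))
  have "paintable TYPE('k) M" if "thin_sums_matroid TYPE('k) M"
    using that thin_represents_imp_paintable[OF assms(2)] unfolding thin_sums_matroid_def by blast
  moreover have "thin_sums_matroid TYPE('k) M" if "paintable TYPE('k) M"
    using paintable_imp_thin_sums_matroid[OF assms(2) that] .
  moreover have "representable TYPE('k) N"
    if "paintable TYPE('k) M" "minor N M" "finite (ground N)" for N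
    using that painting_imp_minor_representable unfolding paintable_def by blast
  moreover have "paintable TYPE('k) M"
    if "\<forall>N. minor N M \<and> finite (ground N) \<longrightarrow> representable TYPE('k) N"
    using minors_representable_imp_paintable[OF assms(2)] that by blast
  ultimately show ?thesis by blast
qed

end
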